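(* Let $G$ be the first Grigorchuk group, and let $\mathrm{St}_G(1^\infty)$ be the stabilizer in $G$ of the infinite ray $1^\infty=111\ldots$ of the rooted binary tree. Then the critical constant for recurrence satisfies $$c_{\mathrm{rt}}\left(G,\mathrm{St}_G(1^\infty)\right)=\alpha_0=\frac{\log 2}{\log\lambda_0},$$ where $\lambda_0$ is the positive root of the polynomial $X^3-X^2-2X-4$ (so $\alpha_0\approx0.7674$).
   Context: First Grigorchuk group: the rooted binary tree has the finite words over $\{0,1\}$ as vertices; its boundary is the set of infinite words. Automorphisms act from the right. An automorphism is written $g=(g_0,g_1)\tau$ with $\tau$ a permutation of $\{0,1\}$, meaning $(iw)\cdot g=(i\cdot\tau)(w\cdot g_i)$. With $\varepsilon$ the transposition of $0,1$, set $a=(id,id)\varepsilon$, and recursively $b=(a,c)$, $c=(a,d)$, $d=(id,b)$. $G$ is generated by $S=\{a,b,c,d\}$. Critical constant for recurrence: let $\Gamma$ be a finitely generated group with word length $l$, and let $H<\Gamma$ be a subgroup of infinite index. Then $c_{\mathrm{rt}}(\Gamma,H)$ is the supremum of all $\beta\ge0$ for which there exists a symmetric probability measure $\mu$ on $\Gamma$ with $\sum_{g\in\Gamma}l(g)^\beta\mu(g)<\infty$ such that the induced random walk on $H\backslash\Gamma$, with transition kernel $P_\mu(Hx,Hy)=\sum_g\mu(g)\mathbf 1_{\{Hxg=Hy\}}$, is transient. *)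

theory Defs
  imports "HOL-Probability.Probability" "HOL-Algebra.Algebra"
begin

section \<open>The critical constant for recurrence\<close>

definition word_length :: "('a, 'm) monoid_scheme \<Rightarrow> 'a set \<Rightarrow> 'a \<Rightarrow> nat" where
  "word_length \<Gamma> S g =
     (LEAST n. \<exists>ws. length ws = n \<and> set ws \<subseteq> S \<union> m_inv \<Gamma> ` S \<and>
        foldr (\<lambda>s h. s \<otimes>\<^bsub>\<Gamma>\<^esub> h) ws \<one>\<^bsub>\<Gamma>\<^esub> = g)"

definition symmetric_prob :: "('a, 'm) monoid_scheme \<Rightarrow> 'a pmf \<Rightarrow> bool" where
  "symmetric_prob \<Gamma> \<mu> \<longleftrightarrow>
     set_pmf \<mu> \<subseteq> carrier \<Gamma> \<and> (\<forall>g\<in>carrier \<Gamma>. pmf \<mu> (inv\<^bsub>\<Gamma>\<^esub> g) = pmf \<mu> g)"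

text \<open>The convention \<open>0 powr 0 = 0\<close> affects only the term of the identity, hence not
  the finiteness of the moment.\<close>

definition finite_moment ::
  "('a, 'm) monoid_scheme \<Rightarrow> 'a set \<Rightarrow> real \<Rightarrow> 'a pmf \<Rightarrow> bool" where
  "finite_moment \<Gamma> S \<beta> \<mu> \<longleftrightarrow>
     (\<lambda>g. real (word_length \<Gamma> S g) powr \<beta> * pmf \<mu> g) summable_on carrier \<Gamma>"

text \<open>The states are the right cosets \<open>A = Hx\<close>; then \<open>A #> g\<close> is \<open>Hxg\<close>.\<close>

definition coset_kernel ::
  "('a, 'm) monoid_scheme \<Rightarrow> 'a pmf \<Rightarrow> 'a set \<Rightarrow> 'a set \<Rightarrow> real" where
  "coset_kernel \<Gamma> \<mu> A B =
     (\<Sum>\<^sub>\<infinity>g\<in>carrier \<Gamma>. pmf \<mu> g * of_bool (A #>\<^bsub>\<Gamma>\<^esub> g = B))"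

primrec kernel_power :: "'s set \<Rightarrow> ('s \<Rightarrow> 's \<Rightarrow> real) \<Rightarrow> nat \<Rightarrow> 's \<Rightarrow> 's \<Rightarrow> real" where
  "kernel_power V P 0 x y = of_bool (x = y)"
| "kernel_power V P (Suc n) x y = (\<Sum>\<^sub>\<infinity>z\<in>V. P x z * kernel_power V P n z y)"

text \<open>Every state has a finite Green function (expected number of visits) on the diagonal.\<close>

definition transient_chain :: "'s set \<Rightarrow> ('s \<Rightarrow> 's \<Rightarrow> real) \<Rightarrow> bool" where
  "transient_chain V P \<longleftrightarrow> (\<forall>x\<in>V. summable (\<lambda>n. kernel_power V P n x x))"

text \<open>\<open>S\<close> is meant to be a finite generating set of the group \<open>\<Gamma>\<close>, and \<open>H\<close> a subgroup of
  infinite index. The supremum is taken in the extended reals since the set of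
  exponents may be unbounded.\<close>

definition crit_const_rec :: "('a, 'm) monoid_scheme \<Rightarrow> 'a set \<Rightarrow> 'a set \<Rightarrow> ereal" where
  "crit_const_rec \<Gamma> S H =
     Sup (ereal ` {\<beta>. 0 \<le> \<beta> \<and>
       (\<exists>\<mu>. symmetric_prob \<Gamma> \<mu> \<and> finite_moment \<Gamma> S \<beta> \<mu> \<and>
            transient_chain (rcosets\<^bsub>\<Gamma>\<^esub> H) (coset_kernel \<Gamma> \<mu>))})"


section \<open>Automorphisms of the rooted binary tree\<close>

text \<open>Vertices are finite words over \<open>{0,1}\<close>, with \<open>False\<close> for 0 and \<open>True\<close> for 1;
  the root is the empty word.\<close>

definition child :: "bool list \<Rightarrow> bool list \<Rightarrow> bool" where
  "child v w \<longleftrightarrow> (\<exists>i. w = v @ [i])"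

definition tree_automorphism :: "(bool list \<Rightarrow> bool list) \<Rightarrow> bool" where
  "tree_automorphism g \<longleftrightarrow>
     bij g \<and> g [] = [] \<and> (\<forall>v w. child (g v) (g w) \<longleftrightarrow> child v w)"

text \<open>Automorphisms act from the right: \<open>w \<cdot> g\<close> is written \<open>g w\<close>, so the product
  \<open>gh\<close> applies \<open>g\<close> first.\<close>

definition tree_aut_group :: "(bool list \<Rightarrow> bool list) monoid" where
  "tree_aut_group =
     \<lparr>carrier = Collect tree_automorphism, mult = (\<lambda>g h. h \<circ> g), one = id\<rparr>"

definition wreath ::
  "(bool list \<Rightarrow> bool list) \<Rightarrow> (bool list \<Rightarrow> bool list) \<Rightarrow> (bool \<Rightarrow> bool) \<Rightarrow> bool list \<Rightarrow> bool list"
  where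
  "wreath g0 g1 \<tau> w =
     (case w of [] \<Rightarrow> [] | i # v \<Rightarrow> \<tau> i # (if i then g1 else g0) v)"

text \<open>The action of a tree automorphism on the boundary: the first \<open>n\<close> letters of the image
  of \<open>\<xi>\<close> form the image of the first \<open>n\<close> letters of \<open>\<xi>\<close>.\<close>

definition boundary_action :: "(bool list \<Rightarrow> bool list) \<Rightarrow> (nat \<Rightarrow> bool) \<Rightarrow> nat \<Rightarrow> bool" where
  "boundary_action g \<xi> = (\<lambda>n. g (map \<xi> [0..<Suc n]) ! n)"


section \<open>The first Grigorchuk group\<close>

definition gr_a :: "bool list \<Rightarrow> bool list" where
  "gr_a = wreath id id Not"

fun gr_b :: "bool list \<Rightarrow> bool list"
  and gr_c :: "bool list \<Rightarrow> bool list"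
  and gr_d :: "bool list \<Rightarrow> bool list" where
  "gr_b [] = []"
| "gr_b (i # w) = i # (if i then gr_c w else gr_a w)"
| "gr_c [] = []"
| "gr_c (i # w) = i # (if i then gr_d w else gr_a w)"
| "gr_d [] = []"
| "gr_d (i # w) = i # (if i then gr_b w else w)"

lemma gr_b_wreath: "gr_b = wreath gr_a gr_c id"
  and gr_c_wreath: "gr_c = wreath gr_a gr_d id"
  and gr_d_wreath: "gr_d = wreath id gr_b id"
  by (rule ext, simp add: wreath_def split: list.split)+

definition gr_gens :: "(bool list \<Rightarrow> bool list) set" where
  "gr_gens = {gr_a, gr_b, gr_c, gr_d}"

definition grigorchuk_group :: "(bool list \<Rightarrow> bool list) monoid" where
  "grigorchuk_group = subgroup_generated tree_aut_group gr_gens"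

definition ray_stabilizer ::
  "(bool list \<Rightarrow> bool list) monoid \<Rightarrow> (nat \<Rightarrow> bool) \<Rightarrow> (bool list \<Rightarrow> bool list) set" where
  "ray_stabilizer \<Gamma> \<xi> = {g \<in> carrier \<Gamma>. boundary_action g \<xi> = \<xi>}"

text \<open>\<open>subgroup_generated\<close> intersects the generating set with the carrier; the following
  facts show that this is harmless here, and that the ambient structure is a group.\<close>

lemma group_tree_aut_group: "group tree_aut_group"
proof (rule groupI, goal_cases)
  case (5 g)
  then have g: "bij g" "g [] = []" "\<And>v w. child (g v) (g w) \<longleftrightarrow> child v w"
    by (auto simp: tree_aut_group_def tree_automorphism_def)
  define h where "h = inv_into UNIV g"
  have gh: "g (h v) = v" and hg: "h (g v) = v" for v
    using g(1) by (simp_all add: h_def bij_is_surj surj_f_inv_f bij_is_inj)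
  have "bij h" using g(1) by (simp add: h_def bij_imp_bij_inv)
  moreover have "h [] = []" using hg[of "[]"] g(2) by simp
  moreover have "child (h v) (h w) \<longleftrightarrow> child v w" for v w
    using g(3)[of "h v" "h w"] gh by simp
  ultimately have "tree_automorphism h" by (simp add: tree_automorphism_def)
  moreover have "g \<circ> h = id" using gh by auto
  ultimately show ?case by (auto simp: tree_aut_group_def)
next
  case (1 g h)
  then show ?case by (simp add: tree_aut_group_def tree_automorphism_def bij_comp)
qed (simp_all add: tree_aut_group_def tree_automorphism_def comp_assoc)

lemma gr_gens_involution:
  "gr_a (gr_a w) = w" "gr_b (gr_b w) = w" "gr_c (gr_c w) = w" "gr_d (gr_d w) = w"
proof -
  show a: "gr_a (gr_a w) = w" for w
    by (auto simp: gr_a_def wreath_def split: list.split)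
  have "gr_b (gr_b w) = w \<and> gr_c (gr_c w) = w \<and> gr_d (gr_d w) = w"
    by (induction w) (auto simp: a)
  then show "gr_b (gr_b w) = w" "gr_c (gr_c w) = w" "gr_d (gr_d w) = w" by auto
qed

lemma gr_gens_subset: "gr_gens \<subseteq> carrier tree_aut_group"
proof -
  have tree: "tree_automorphism g"
    if inv: "\<And>w. g (g w) = w" and nil: "g [] = []"
      and ext: "\<And>w i. \<exists>j. g (w @ [i]) = g w @ [j]" for g
  proof -
    have 1: "child (g v) (g w)" if "child v w" for v w
      using that ext by (auto simp: child_def)
    have "child v w" if "child (g v) (g w)" for v w
      using 1[OF that] inv by simp
    moreover have "bij g" using inv by (rule involuntory_imp_bij)
    ultimately show ?thesis using 1 nil unfolding tree_automorphism_def by blast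
  qed
  have a: "\<exists>j. gr_a (w @ [i]) = gr_a w @ [j]" for w i
    by (cases w) (auto simp: gr_a_def wreath_def)
  have bcd: "(\<exists>j. gr_b (w @ [i]) = gr_b w @ [j]) \<and> (\<exists>j. gr_c (w @ [i]) = gr_c w @ [j]) \<and>
      (\<exists>j. gr_d (w @ [i]) = gr_d w @ [j])" for w i
  proof (induction w)
    case Nil
    show ?case by (simp add: gr_a_def wreath_def)
  next
    case (Cons k w)
    then show ?case using a[of w i] by (cases k) simp_all
  qed
  have "tree_automorphism gr_a"
    using gr_gens_involution(1) a by (intro tree) (auto simp: gr_a_def wreath_def)
  moreover have "tree_automorphism gr_b" "tree_automorphism gr_c" "tree_automorphism gr_d"
    using gr_gens_involution bcd by (auto intro: tree)
  ultimately show ?thesis by (auto simp: gr_gens_def tree_aut_group_def)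
qed

lemma group_grigorchuk_group: "group grigorchuk_group"
  unfolding grigorchuk_group_def
  by (rule group.group_subgroup_generated[OF group_tree_aut_group])

lemma carrier_grigorchuk_group:
  "carrier grigorchuk_group = generate tree_aut_group gr_gens"
  using gr_gens_subset
  by (simp add: grigorchuk_group_def carrier_subgroup_generated Int_absorb1)


section \<open>The constant \<open>\<lambda>\<^sub>0\<close>\<close>

lemma ex1_lambda0: "\<exists>!x::real. x > 0 \<and> poly [:-4, -2, -1, 1:] x = 0"
proof (rule ex_ex1I)
  have "\<exists>x. 2 \<le> x \<and> x \<le> 3 \<and> poly [:-4, -2, -1, 1:] x = (0::real)"
  proof (rule IVT')
    show "continuous_on {2..3} (poly [:-4, -2, -1, 1:] :: real \<Rightarrow> real)"
      by (rule continuous_on_poly) (rule continuous_on_id)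
  qed simp_all
  then show "\<exists>x::real. x > 0 \<and> poly [:-4, -2, -1, 1:] x = 0"
    by (meson less_le_trans zero_less_numeral)
next
  fix x y :: real
  assume x: "x > 0 \<and> poly [:-4, -2, -1, 1:] x = 0" and y: "y > 0 \<and> poly [:-4, -2, -1, 1:] y = 0"
  have less: False
    if "0 < u" "u < v" and u: "poly [:-4, -2, -1, 1:] u = 0" and v: "poly [:-4, -2, -1, 1:] v = 0"
    for u v :: real
  proof -
    have eq: "1 = 1/t + 2/t^2 + 4/t^3" if "t > 0" "poly [:-4, -2, -1, 1:] t = 0" for t :: real
    proof -
      have "t^3 = t^2 + 2 * t + 4"
        using that by (simp add: algebra_simps power2_eq_square power3_eq_cube)
      then have "1 = (t^2 + 2 * t + 4) / t^3"
        using that(1) by (metis divide_self less_irrefl zero_less_power)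
      also have "\<dots> = t^2 / t^3 + 2 * t / t^3 + 4 / t^3" by (simp add: add_divide_distrib)
      finally show ?thesis using that by (simp add: power2_eq_square power3_eq_cube)
    qed
    have "1/v < 1/u" "2/v^2 < 2/u^2" "4/v^3 < 4/u^3"
      using \<open>0 < u\<close> \<open>u < v\<close> by (simp_all add: divide_strict_left_mono power_strict_mono)
    with eq[of u] eq[of v] that show False by linarith
  qed
  show "x = y" using less[of x y] less[of y x] x y by (cases x y rule: linorder_cases) auto
qed

definition lambda0 :: real where
  "lambda0 = (THE x. x > 0 \<and> poly [:-4, -2, -1, 1:] x = 0)"

end

theory Submission
  imports Defs
begin

text \<open>The right cosets of the stabilizer of the ray \<open>1\<^sup>\<infinity>\<close> are the points of its orbit, and these are rays
with only finitely many letters 0. Let \<open>I\<^sub>n\<close> (\<open>ones_from n\<close>) be the set of the \<open>2\<^sup>n\<close> rays all of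
whose letters are 1 from index \<open>n\<close> on. The theorem rests on one quantity: the number of points
of \<open>I\<^sub>n\<close> that a group element \<open>g\<close> of length \<open>l\<close> moves out of \<open>I\<^sub>n\<close>. It is at most of the order
\<open>l\<^sup>\<alpha>\<close> with \<open>\<alpha> = log 2 / log \<lambda>\<^sub>0\<close>, uniformly in \<open>n\<close>, and this bound is attained.

The bound (\<open>crossings_le_length_powr\<close>) comes from Bartholdi's contraction: for suitable weights of
the generators the two sections of \<open>g\<close> have total weight at most \<open>\<eta>\<close> times the weight of \<open>g\<close> plus
a constant, where \<open>\<eta> = 2 / \<lambda>\<^sub>0\<close>. After \<open>m\<close> levels the \<open>2\<^sup>m\<close> sections have total weight of order
\<open>\<eta>\<^sup>m l + 2\<^sup>m\<close>, which is of order \<open>2\<^sup>m = l\<^sup>\<alpha>\<close> once \<open>\<lambda>\<^sub>0\<^sup>m\<close> reaches \<open>l\<close>. That it is attained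
(\<open>act_flip_word\<close>, \<open>length_flip_word\<close>) is shown by a substitution on words that inverts the
passage to sections without any loss of weight: it produces words of length of order
\<open>\<lambda>\<^sub>0\<^sup>n\<close> that flip letter \<open>n\<close> of every ray in \<open>I\<^bsub>n+1\<^esub>\<close>, and hence exchange \<open>I\<^sub>n\<close> with its complement there.

Since \<open>\<mu>\<close> is symmetric, the induced walk is reversible for the counting measure, and it can be
treated through its Dirichlet form. It is transient only if finitely supported functions with
value 1 at a given point have Dirichlet form bounded away from 0
(\<open>dirichlet_lower_bound_if_summable\<close>). If \<open>\<mu>\<close> has a finite moment of order \<open>\<alpha>\<close>, the averages of the
indicators of \<open>I\<^sub>0, \<dots>, I\<^bsub>N-1\<^esub>\<close> violate this: by the crossing bound \<open>g\<close> contributes at most of order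
\<open>min 1 (l/N) \<cdot> l\<^sup>\<alpha>\<close>, and the sum over \<open>\<mu>\<close> tends to 0 by domination. So no exponent
above \<open>\<alpha>\<close> is admissible.

Conversely, an inequality \<open>u(x)\<^sup>2 \<le> C D(u)\<close> for all summable \<open>u\<close> forces transience
(\<open>summable_heat_if_dirichlet_bound\<close>). Let \<open>\<mu>\<close> give the \<open>n\<close>-th flipping element and its inverse a mass of
order \<open>r\<^sup>n\<close>. The averages of \<open>u\<close> over sets of \<open>2\<^sup>n\<close> points that double under the flips
change at step \<open>n\<close> by at most a multiple of \<open>(2r)\<^bsup>-n/2\<^esup> \<surd>D(u)\<close>, and they tend to 0; so the inequality holds
as soon as \<open>r > 1/2\<close>. The moment of order \<open>\<beta>\<close> is finite as soon as \<open>r \<lambda>\<^sub>0\<^sup>\<beta> < 1\<close>, and the two conditions are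
compatible exactly if \<open>\<lambda>\<^sub>0\<^sup>\<beta> < 2\<close>, that is \<open>\<beta> < \<alpha>\<close>.\<close>

section \<open>Summation\<close>

lemma summable_on_mult_bounded:
  fixes f c :: "'a \<Rightarrow> real"
  assumes f: "f summable_on W" and c: "\<And>w. w \<in> W \<Longrightarrow> \<bar>c w\<bar> \<le> C"
  shows "(\<lambda>w. f w * c w) summable_on W"
proof -
  have "(\<lambda>w. C * \<bar>f w\<bar>) summable_on W"
    using f summable_on_iff_abs_summable_on_real[of f W] by (intro summable_on_cmult_right) simp
  then have "(\<lambda>w. norm (f w * c w)) summable_on W"
  proof (rule Infinite_Sum.abs_summable_on_comparison_test')
    fix w assume "w \<in> W"
    then show "norm (f w * c w) \<le> C * \<bar>f w\<bar>"
      using c[of w] by (simp add: abs_mult mult.commute mult_right_mono)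
  qed
  then show ?thesis by (rule Infinite_Sum.abs_summable_summable)
qed

lemma summable_on_bounded:
  fixes f :: "'a \<Rightarrow> real"
  assumes "f summable_on W"
  shows "\<exists>C. \<forall>w\<in>W. \<bar>f w\<bar> \<le> C"
proof (intro exI ballI)
  fix w assume w: "w \<in> W"
  have "(\<lambda>w. \<bar>f w\<bar>) summable_on W"
    using assms summable_on_iff_abs_summable_on_real[of f W] by simp
  then show "\<bar>f w\<bar> \<le> (\<Sum>\<^sub>\<infinity>w\<in>W. \<bar>f w\<bar>)"
    using finite_sum_le_infsum[of "\<lambda>w. \<bar>f w\<bar>" W "{w}"] w by simp
qed

lemma has_sum_finite_sum:
  fixes f :: "'b \<Rightarrow> 'a \<Rightarrow> real"
  assumes "finite Z" "\<And>z. z \<in> Z \<Longrightarrow> (f z has_sum s z) W"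
  shows "((\<lambda>g. \<Sum>z\<in>Z. f z g) has_sum (\<Sum>z\<in>Z. s z)) W"
  using assms by (induction Z rule: finite_induct) (auto intro: has_sum_add)

text \<open>A dominated convergence: outside a large finite set the sum of \<open>\<psi>\<close> is small, and inside
it the factor \<open>l g / N\<close> is.\<close>

lemma infsum_min_arbitrarily_small:
  fixes \<psi> l :: "'a \<Rightarrow> real"
  assumes \<psi>: "\<psi> summable_on W" "\<And>g. g \<in> W \<Longrightarrow> 0 \<le> \<psi> g" and l: "\<And>g. 0 \<le> l g" and "0 < \<epsilon>"
  shows "\<exists>N>0. (\<Sum>\<^sub>\<infinity>g\<in>W. \<psi> g * min 1 (l g / real N)) < \<epsilon>"
proof -
  obtain F where F: "finite F" "F \<subseteq> W" "dist (sum \<psi> F) (infsum \<psi> W) \<le> \<epsilon> / 2"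
    using infsum_finite_approximation[OF \<psi>(1), of "\<epsilon> / 2"] \<open>0 < \<epsilon>\<close> by auto
  define M where "M = (\<Sum>g\<in>F. \<psi> g * l g)"
  obtain N :: nat where N: "M / (\<epsilon> / 4) < N" using reals_Archimedean2 by blast
  have M0: "0 \<le> M" unfolding M_def using F \<psi> l by (intro sum_nonneg mult_nonneg_nonneg) auto
  have N0: "0 < real N" using N divide_nonneg_pos[OF M0, of "\<epsilon> / 4"] \<open>0 < \<epsilon>\<close> by linarith
  have MN: "M / N \<le> \<epsilon> / 4" using N N0 \<open>0 < \<epsilon>\<close> by (simp add: field_simps)
  have sm: "(\<lambda>g. \<psi> g * min 1 (l g / real N)) summable_on W"
    using l by (intro summable_on_mult_bounded[OF \<psi>(1), where C = 1]) simp
  have "(\<Sum>\<^sub>\<infinity>g\<in>W. \<psi> g * min 1 (l g / real N)) =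
      (\<Sum>g\<in>F. \<psi> g * min 1 (l g / real N)) + (\<Sum>\<^sub>\<infinity>g\<in>W - F. \<psi> g * min 1 (l g / real N))"
    using F infsum_Un_disjoint[of "\<lambda>g. \<psi> g * min 1 (l g / real N)" F "W - F"]
      summable_on_subset_banach[OF sm, of "W - F"]
    by (simp add: Un_absorb1)
  also have "(\<Sum>g\<in>F. \<psi> g * min 1 (l g / real N)) \<le> (\<Sum>g\<in>F. \<psi> g * (l g / real N))"
    using F \<psi> by (intro sum_mono mult_left_mono) auto
  also have "\<dots> = M / N" by (simp add: M_def sum_divide_distrib)
  also have "(\<Sum>\<^sub>\<infinity>g\<in>W - F. \<psi> g * min 1 (l g / real N)) \<le> (\<Sum>\<^sub>\<infinity>g\<in>W - F. \<psi> g)"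
    using \<psi> summable_on_subset_banach[OF sm, of "W - F"] summable_on_subset_banach[OF \<psi>(1), of "W - F"]
    by (intro infsum_mono) (auto intro: mult_left_le)
  also have "(\<Sum>\<^sub>\<infinity>g\<in>W - F. \<psi> g) = infsum \<psi> W - sum \<psi> F"
    using F infsum_Un_disjoint[of \<psi> F "W - F"] summable_on_subset_banach[OF \<psi>(1), of "W - F"]
    by (simp add: Un_absorb1)
  also have "\<dots> \<le> \<epsilon> / 2" using F(3) unfolding dist_real_def by linarith
  finally have "(\<Sum>\<^sub>\<infinity>g\<in>W. \<psi> g * min 1 (l g / real N)) \<le> M / N + \<epsilon> / 2" by simp
  then have "(\<Sum>\<^sub>\<infinity>g\<in>W. \<psi> g * min 1 (l g / real N)) < \<epsilon>" using MN \<open>0 < \<epsilon>\<close> by linarith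
  then show ?thesis using N0 by (intro exI[of _ N]) simp
qed

lemma pmf_has_sum:
  assumes "set_pmf p \<subseteq> W"
  shows "(pmf p has_sum 1) W"
proof -
  have "pmf p summable_on W"
    using abs_summable_equivalent[of "pmf p" W] pmf_abs_summable[of p W]
      Infinite_Sum.abs_summable_summable[of "pmf p" W] by blast
  moreover have "infsum (pmf p) W = 1"
    using infsetsum_infsum[OF pmf_abs_summable[of p W]] infsetsum_pmf_eq_1[OF assms] by simp
  ultimately show ?thesis by (simp add: has_sum_iff)
qed

lemma integrable_imp_summable_on_pmf:
  fixes h :: "'a \<Rightarrow> real"
  assumes "integrable (measure_pmf p) h"
  shows "(\<lambda>x. h x * pmf p x) summable_on W"
proof -
  have "integrable (count_space UNIV) (\<lambda>x. pmf p x *\<^sub>R h x)"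
    using assms unfolding measure_pmf_eq_density by (subst (asm) integrable_density) auto
  then have "integrable (count_space UNIV) (\<lambda>x. h x * pmf p x)" by (simp add: mult.commute)
  then have "Infinite_Sum.abs_summable_on (\<lambda>x. h x * pmf p x) UNIV"
    unfolding abs_summable_equivalent abs_summable_on_def .
  then have "(\<lambda>x. h x * pmf p x) summable_on UNIV" by (rule Infinite_Sum.abs_summable_summable)
  then show ?thesis by (rule summable_on_subset_banach) simp
qed

section \<open>Symmetric kernels and their Dirichlet forms\<close>

text \<open>All functions are taken absolutely summable on \<open>V\<close>. This class contains the powers of
the kernel and is preserved by it, and on it every double sum over \<open>V \<times> V\<close> converges absolutely,
so that summations may be interchanged freely.\<close>

locale symmetric_kernel =
  fixes V :: "'s set" and P :: "'s \<Rightarrow> 's \<Rightarrow> real"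
  assumes P_nonneg: "\<And>x y. x \<in> V \<Longrightarrow> y \<in> V \<Longrightarrow> 0 \<le> P x y"
    and P_sym: "\<And>x y. x \<in> V \<Longrightarrow> y \<in> V \<Longrightarrow> P x y = P y x"
    and P_row: "\<And>x. x \<in> V \<Longrightarrow> (P x has_sum 1) V"
begin

definition ip :: "('s \<Rightarrow> real) \<Rightarrow> ('s \<Rightarrow> real) \<Rightarrow> real" where
  "ip u v = (\<Sum>\<^sub>\<infinity>x\<in>V. u x * v x)"

definition step :: "('s \<Rightarrow> real) \<Rightarrow> 's \<Rightarrow> real" where
  "step u x = (\<Sum>\<^sub>\<infinity>y\<in>V. P x y * u y)"

text \<open>The Dirichlet form as the bilinear form of \<open>I - P\<close>; \<open>dirichlet\<close> below is twice its diagonal, in the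
shape of a sum of squares, from which positivity and lower bounds can be read off.\<close>

definition form :: "('s \<Rightarrow> real) \<Rightarrow> ('s \<Rightarrow> real) \<Rightarrow> real" where
  "form u v = ip u v - ip (step u) v"

definition dirichlet :: "('s \<Rightarrow> real) \<Rightarrow> real" where
  "dirichlet u = (\<Sum>\<^sub>\<infinity>(x, y)\<in>V \<times> V. P x y * (u x - u y)\<^sup>2)"

lemma P_weight_left:
  assumes u: "u summable_on V"
  shows "(\<lambda>(x, y). P x y * u x) summable_on V \<times> V"
proof -
  have row: "((\<lambda>y. \<bar>P x y * u x\<bar>) has_sum \<bar>u x\<bar>) V" if "x \<in> V" for x
  proof -
    have "((\<lambda>y. P x y * \<bar>u x\<bar>) has_sum (1 * \<bar>u x\<bar>)) V"
      by (rule has_sum_cmult_left[OF P_row[OF that]])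
    moreover have "\<bar>P x y * u x\<bar> = P x y * \<bar>u x\<bar>" if "y \<in> V" for y
      using P_nonneg[OF \<open>x \<in> V\<close> that] by (simp add: abs_mult)
    ultimately show ?thesis by (subst has_sum_cong[where g = "\<lambda>y. P x y * \<bar>u x\<bar>"]) simp_all
  qed
  have "(\<lambda>z. norm (case z of (x, y) \<Rightarrow> P x y * u x)) summable_on Sigma V (\<lambda>_. V)"
  proof (subst Infinite_Sum.abs_summable_on_Sigma_iff, intro conjI ballI)
    fix x assume "x \<in> V"
    then show "(\<lambda>y. norm (case (x, y) of (x, y) \<Rightarrow> P x y * u x)) summable_on V"
      using row has_sum_imp_summable by auto
  next
    have "(\<lambda>x. \<bar>u x\<bar>) summable_on V"
      using u summable_on_iff_abs_summable_on_real[of u V] by simp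
    moreover have "(\<Sum>\<^sub>\<infinity>y\<in>V. \<bar>P x y * u x\<bar>) = \<bar>u x\<bar>" if "x \<in> V" for x
      using row[OF that] by (rule infsumI)
    ultimately show "(\<lambda>x. norm (\<Sum>\<^sub>\<infinity>y\<in>V. norm (case (x, y) of (x, y) \<Rightarrow> P x y * u x))) summable_on V"
      by (simp cong: summable_on_cong)
  qed
  then show ?thesis by (rule Infinite_Sum.abs_summable_summable)
qed

lemma P_weight_right:
  assumes "u summable_on V"
  shows "(\<lambda>(x, y). P x y * u y) summable_on V \<times> V"
proof -
  have "(\<lambda>(y, x). P x y * u y) summable_on V \<times> V"
    using P_weight_left[OF assms] by (rule summable_on_cong[THEN iffD1, rotated]) (auto simp: P_sym)
  then show ?thesis
    using summable_on_swap[of "\<lambda>(x, y). P x y * u y" V V] by (simp add: case_prod_unfold)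
qed

lemma step_summable:
  assumes "u summable_on V"
  shows "step u summable_on V"
  using summable_on_Sigma_banach[OF P_weight_right[OF assms]] by (simp add: step_def[abs_def])

lemma step_ip:
  assumes u: "u summable_on V" and v: "v summable_on V"
  shows "(\<lambda>(x, y). P x y * u y * v x) summable_on V \<times> V"
    and "ip (step u) v = (\<Sum>\<^sub>\<infinity>(x, y)\<in>V \<times> V. P x y * u y * v x)"
proof -
  obtain C where C: "\<And>x. x \<in> V \<Longrightarrow> \<bar>v x\<bar> \<le> C" using summable_on_bounded[OF v] by blast
  have "(\<lambda>z. (case z of (x, y) \<Rightarrow> P x y * u y) * v (fst z)) summable_on V \<times> V"
    by (rule summable_on_mult_bounded[OF P_weight_right[OF u], where C = C]) (auto simp: C)
  then show *: "(\<lambda>(x, y). P x y * u y * v x) summable_on V \<times> V"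
    by (simp add: case_prod_unfold)
  show "ip (step u) v = (\<Sum>\<^sub>\<infinity>(x, y)\<in>V \<times> V. P x y * u y * v x)"
    using infsum_Sigma'_banach[OF *]
    by (simp add: ip_def step_def infsum_cmult_left'[symmetric])
qed

lemma step_sym:
  assumes u: "u summable_on V" and v: "v summable_on V"
  shows "ip (step u) v = ip u (step v)"
proof -
  have "ip (step u) v = (\<Sum>\<^sub>\<infinity>(x, y)\<in>V \<times> V. P x y * u y * v x)"
    by (rule step_ip[OF u v])
  also have "\<dots> = (\<Sum>\<^sub>\<infinity>(x, y)\<in>V \<times> V. P x y * v y * u x)"
    by (rule infsum_reindex_bij_witness[of _ prod.swap prod.swap]) (auto simp: P_sym)
  also have "\<dots> = ip (step v) u" by (rule step_ip(2)[OF v u, symmetric])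
  finally show ?thesis by (simp add: ip_def mult.commute)
qed

lemma ip_summable:
  fixes u v :: "'s \<Rightarrow> real"
  assumes "u summable_on V" "v summable_on V"
  shows "(\<lambda>x. u x * v x) summable_on V"
  using summable_on_bounded[OF assms(2)] summable_on_mult_bounded[OF assms(1)] by blast

text \<open>Row sums equal 1, so summing \<open>P x y\<close> over the free variable leaves the sum of squares.\<close>

lemma diag_left:
  assumes u: "u summable_on V"
  shows "((\<lambda>(x, y). P x y * (u x)\<^sup>2) has_sum ip u u) (V \<times> V)"
proof -
  have *: "(\<lambda>x. (u x)\<^sup>2) summable_on V"
    using ip_summable[OF u u] by (simp add: power2_eq_square)
  have "(\<Sum>\<^sub>\<infinity>(x, y)\<in>V \<times> V. P x y * (u x)\<^sup>2) = (\<Sum>\<^sub>\<infinity>x\<in>V. \<Sum>\<^sub>\<infinity>y\<in>V. P x y * (u x)\<^sup>2)"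
    by (rule infsum_Sigma'_banach[OF P_weight_left[OF *], symmetric])
  also have "\<dots> = (\<Sum>\<^sub>\<infinity>x\<in>V. (u x)\<^sup>2)"
    by (rule infsum_cong) (use P_row in \<open>simp add: infsum_cmult_left' infsumI\<close>)
  finally show ?thesis
    using P_weight_left[OF *] by (simp add: has_sum_iff ip_def power2_eq_square)
qed

lemma diag_right:
  assumes u: "u summable_on V"
  shows "((\<lambda>(x, y). P x y * (u y)\<^sup>2) has_sum ip u u) (V \<times> V)"
proof -
  have "((\<lambda>(x, y). P x y * (u y)\<^sup>2) has_sum ip u u) (V \<times> V) \<longleftrightarrow>
      ((\<lambda>(x, y). P x y * (u x)\<^sup>2) has_sum ip u u) (V \<times> V)"
    by (rule has_sum_reindex_bij_witness[of _ prod.swap prod.swap]) (auto simp: P_sym)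
  then show ?thesis using diag_left[OF u] by simp
qed

lemma dirichlet_form:
  assumes u: "u summable_on V"
  shows "((\<lambda>(x, y). P x y * (u x - u y)\<^sup>2) has_sum 2 * form u u) (V \<times> V)"
proof -
  have c: "((\<lambda>(x, y). P x y * u y * u x) has_sum ip (step u) u) (V \<times> V)"
    using step_ip[OF u u] by (simp add: has_sum_iff)
  have "((\<lambda>z. (case z of (x, y) \<Rightarrow> P x y * (u x)\<^sup>2) + (case z of (x, y) \<Rightarrow> P x y * (u y)\<^sup>2) +
      (-2) * (case z of (x, y) \<Rightarrow> P x y * u y * u x)) has_sum
      (ip u u + ip u u + (-2) * ip (step u) u)) (V \<times> V)"
    by (intro has_sum_add has_sum_cmult_right diag_left diag_right c u)
  moreover have "(\<lambda>z. (case z of (x, y) \<Rightarrow> P x y * (u x)\<^sup>2) + (case z of (x, y) \<Rightarrow> P x y * (u y)\<^sup>2) +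
      (-2) * (case z of (x, y) \<Rightarrow> P x y * u y * u x)) = (\<lambda>(x, y). P x y * (u x - u y)\<^sup>2)"
    by (auto simp: fun_eq_iff algebra_simps power2_eq_square)
  ultimately show ?thesis by (simp add: form_def algebra_simps)
qed

lemma dirichlet_eq: "u summable_on V \<Longrightarrow> dirichlet u = 2 * form u u"
  unfolding dirichlet_def by (rule infsumI) (rule dirichlet_form)

lemma dirichlet_nonneg: "0 \<le> dirichlet u"
  unfolding dirichlet_def by (rule infsum_nonneg) (auto simp: P_nonneg)

lemma finite_sum_le_dirichlet:
  assumes "u summable_on V" "finite Z" "Z \<subseteq> V \<times> V"
  shows "(\<Sum>(x, y)\<in>Z. P x y * (u x - u y)\<^sup>2) \<le> dirichlet u"
  unfolding dirichlet_def
  using dirichlet_form[OF assms(1)] assms(2,3)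
  by (intro finite_sum_le_infsum) (auto simp: has_sum_iff P_nonneg)

lemma ip_add_scaled:
  assumes "u summable_on V" "v summable_on V" "w summable_on V"
  shows "ip (\<lambda>x. u x + t * v x) w = ip u w + t * ip v w"
proof -
  have "ip (\<lambda>x. u x + t * v x) w = (\<Sum>\<^sub>\<infinity>x\<in>V. u x * w x + t * (v x * w x))"
    by (simp add: ip_def algebra_simps)
  also have "\<dots> = ip u w + t * ip v w"
    unfolding ip_def using ip_summable assms
    by (subst infsum_add) (auto intro: summable_on_cmult_right simp: infsum_cmult_right')
  finally show ?thesis .
qed

lemma P_row_summable:
  assumes x: "x \<in> V" and u: "u summable_on V"
  shows "(\<lambda>y. P x y * u y) summable_on V"
proof -
  obtain C where C: "\<And>x. x \<in> V \<Longrightarrow> \<bar>u x\<bar> \<le> C" using summable_on_bounded[OF u] by blast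
  show ?thesis
    by (rule summable_on_mult_bounded[OF has_sum_imp_summable[OF P_row[OF x]] C])
qed

lemma step_add_scaled:
  assumes "u summable_on V" "v summable_on V" "x \<in> V"
  shows "step (\<lambda>x. u x + t * v x) x = step u x + t * step v x"
proof -
  have "step (\<lambda>x. u x + t * v x) x = (\<Sum>\<^sub>\<infinity>y\<in>V. P x y * u y + t * (P x y * v y))"
    by (simp add: step_def algebra_simps)
  also have "\<dots> = step u x + t * step v x"
    unfolding step_def using P_row_summable assms
    by (subst infsum_add) (auto intro: summable_on_cmult_right simp: infsum_cmult_right')
  finally show ?thesis .
qed

lemma form_add_scaled:
  assumes "u summable_on V" "v summable_on V" "w summable_on V"
  shows "form (\<lambda>x. u x + t * v x) w = form u w + t * form v w"
proof -
  have "ip (step (\<lambda>x. u x + t * v x)) w = ip (\<lambda>x. step u x + t * step v x) w"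
    unfolding ip_def by (rule infsum_cong) (simp add: step_add_scaled assms)
  then show ?thesis
    by (simp add: form_def ip_add_scaled step_summable assms algebra_simps)
qed

lemma form_sym:
  assumes "u summable_on V" "v summable_on V"
  shows "form u v = form v u"
  unfolding form_def using step_sym[OF assms] by (simp add: ip_def mult.commute)

lemma form_quadratic:
  assumes u: "u summable_on V" and v: "v summable_on V"
  shows "form (\<lambda>x. u x + t * v x) (\<lambda>x. u x + t * v x) = form u u + 2 * t * form u v + t\<^sup>2 * form v v"
proof -
  have w: "(\<lambda>x. u x + t * v x) summable_on V"
    using u v by (intro summable_on_add summable_on_cmult_right)
  have "form (\<lambda>x. u x + t * v x) (\<lambda>x. u x + t * v x) =
      form (\<lambda>x. u x + t * v x) u + t * form (\<lambda>x. u x + t * v x) v"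
    using form_add_scaled[OF u v w] form_sym[OF w] u v by simp
  also have "\<dots> = form u u + t * form v u + t * (form u v + t * form v v)"
    using u v by (simp add: form_add_scaled)
  finally show ?thesis
    using form_sym[OF v u] by (simp add: algebra_simps power2_eq_square)
qed

text \<open>The column \<open>x \<mapsto> p\<^sub>n(x, r)\<close> of the \<open>n\<close>-th power, rather than a row, because \<open>kernel_power\<close> recurses on
the first step: this makes it the orbit of the indicator of \<open>r\<close> under \<open>step\<close>.\<close>

definition heat :: "'s \<Rightarrow> nat \<Rightarrow> 's \<Rightarrow> real" where
  "heat r n x = kernel_power V P n x r"

definition green :: "'s \<Rightarrow> nat \<Rightarrow> 's \<Rightarrow> real" where
  "green r N x = (\<Sum>n<N. heat r n x)"

lemma heat_Suc: "heat r (Suc n) = step (heat r n)"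
  by (simp add: heat_def step_def fun_eq_iff)

lemma heat_summable:
  shows "heat r n summable_on V"
proof (induction n)
  case 0
  have "(\<lambda>x. of_bool (x = r) :: real) summable_on V"
    by (rule finite_nonzero_values_imp_summable_on) (rule finite_subset[of _ "{r}"], auto)
  then show ?case by (simp add: heat_def[abs_def])
next
  case (Suc n)
  then show ?case by (simp add: heat_Suc step_summable)
qed

lemma heat_nonneg: "x \<in> V \<Longrightarrow> 0 \<le> heat r n x"
proof (induction n arbitrary: x)
  case 0
  show ?case by (simp add: heat_def)
next
  case (Suc n)
  then show ?case unfolding heat_Suc step_def by (intro infsum_nonneg mult_nonneg_nonneg P_nonneg)
qed

lemma ip_heat_0:
  assumes "r \<in> V"
  shows "ip (heat r 0) v = v r"
proof -
  have "ip (heat r 0) v = (\<Sum>\<^sub>\<infinity>x\<in>{r}. v x)"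
    unfolding ip_def by (rule infsum_cong_neutral) (use assms in \<open>auto simp: heat_def\<close>)
  then show ?thesis by simp
qed

lemma ip_heat_heat:
  assumes "r \<in> V"
  shows "ip (heat r m) (heat r n) = heat r (m + n) r"
proof (induction m arbitrary: n)
  case 0
  show ?case by (simp add: ip_heat_0 assms)
next
  case (Suc m)
  have "ip (heat r (Suc m)) (heat r n) = ip (heat r m) (heat r (Suc n))"
    by (simp add: heat_Suc step_sym heat_summable)
  then show ?case using Suc by simp
qed

text \<open>One term of \<open>p\<^bsub>2n\<^esub>(r, r) = \<Sum>\<^sub>x p\<^sub>n(x, r)\<^sup>2\<close>. It carries decay on the diagonal over to all points.\<close>

lemma heat_square_le:
  assumes r: "r \<in> V" and x: "x \<in> V"
  shows "(heat r n x)\<^sup>2 \<le> heat r (2 * n) r"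
proof -
  have "(\<Sum>x\<in>{x}. heat r n x * heat r n x) \<le> ip (heat r n) (heat r n)"
    unfolding ip_def using x
    by (intro finite_sum_le_infsum ip_summable heat_summable) auto
  then show ?thesis by (simp add: ip_heat_heat r power2_eq_square mult_2)
qed

lemma green_summable: "green r N summable_on V"
  unfolding green_def[abs_def]
  by (induction N) (simp_all add: heat_summable summable_on_add)

lemma green_nonneg: "x \<in> V \<Longrightarrow> 0 \<le> green r N x"
  unfolding green_def by (intro sum_nonneg heat_nonneg)

text \<open>Telescoping: \<open>I - P\<close> maps the truncated Green function to \<open>p\<^sub>0 - p\<^sub>N\<close>.\<close>

lemma form_green:
  assumes r: "r \<in> V" and v: "v summable_on V"
  shows "form (green r N) v = v r - ip (heat r N) v"
proof (induction N)
  case 0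
  have "form (green r 0) v = 0" by (simp add: form_def green_def[abs_def] ip_def step_def)
  then show ?case by (simp add: ip_heat_0 r)
next
  case (Suc N)
  have "green r (Suc N) = (\<lambda>x. green r N x + 1 * heat r N x)"
    by (simp add: green_def[abs_def])
  then have "form (green r (Suc N)) v = form (green r N) v + form (heat r N) v"
    using form_add_scaled[OF green_summable heat_summable v, of r N 1 r N] by simp
  also have "form (heat r N) v = ip (heat r N) v - ip (heat r (Suc N)) v"
    by (simp add: form_def heat_Suc)
  finally show ?case using Suc by simp
qed

lemma form_green_green_le:
  assumes r: "r \<in> V"
  shows "form (green r N) (green r N) \<le> green r N r"
  using form_green[OF r green_summable, of N r N]
    infsum_nonneg[of V "\<lambda>x. heat r N x * green r N x"]
  by (simp add: ip_def heat_nonneg green_nonneg)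

text \<open>Applied to the truncated Green function \<open>u\<close> the inequality is self-improving: \<open>D(u)\<close> is at most
\<open>2 u(r)\<close>, so that \<open>u(r)\<close> is at most \<open>2C\<close>.\<close>

lemma summable_heat_if_dirichlet_bound:
  assumes r: "r \<in> V"
    and bound: "\<And>u. u summable_on V \<Longrightarrow> (u r)\<^sup>2 \<le> C * dirichlet u"
  shows "summable (\<lambda>n. kernel_power V P n r r)"
proof -
  have "green r N r \<le> 2 * \<bar>C\<bar>" for N
  proof -
    let ?g = "green r N r"
    have "?g\<^sup>2 \<le> C * dirichlet (green r N)" by (rule bound[OF green_summable])
    also have "\<dots> \<le> \<bar>C\<bar> * dirichlet (green r N)"
      by (intro mult_right_mono dirichlet_nonneg) simp
    also have "\<dots> \<le> \<bar>C\<bar> * (2 * ?g)"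
      using form_green_green_le[OF r] by (intro mult_left_mono) (simp_all add: dirichlet_eq green_summable)
    finally have "?g * ?g \<le> (2 * \<bar>C\<bar>) * ?g" by (simp add: power2_eq_square algebra_simps)
    then show ?thesis
      using green_nonneg[OF r, of r N] by (cases "?g = 0") (auto simp: mult_le_cancel_right)
  qed
  then have "summable (\<lambda>n. heat r n r)"
    by (intro bounded_imp_summable[where B = "2 * \<bar>C\<bar>"] heat_nonneg r)
       (simp add: green_def lessThan_Suc_atMost[symmetric] del: sum.lessThan_Suc)
  then show ?thesis by (simp add: heat_def)
qed

text \<open>Positivity of the form at \<open>g + t f\<close>, with \<open>g\<close> a truncated Green function, gives in the limit
\<open>0 \<le> G + 2 t f(r) + t\<^sup>2 D(f)/2\<close>, because \<open>g\<close> pairs with \<open>f\<close> to \<open>f(r)\<close> up to a term that vanishes at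
infinity; so \<open>D(f)\<close> cannot be small.\<close>

lemma dirichlet_lower_bound_if_summable:
  assumes r: "r \<in> V" and sm: "summable (\<lambda>n. kernel_power V P n r r)"
  shows "\<exists>c>0. \<forall>f. finite {x. f x \<noteq> 0} \<longrightarrow> f r = 1 \<longrightarrow> c \<le> dirichlet f"
proof -
  have sm: "summable (\<lambda>n. heat r n r)" using sm by (simp add: heat_def)
  define G where "G = suminf (\<lambda>n. heat r n r)"
  have G: "green r N r \<le> G" for N
    unfolding green_def G_def by (rule sum_le_suminf[OF sm]) (auto simp: heat_nonneg r)
  have "heat r 0 r \<le> G" using G[of 1] by (simp add: green_def)
  then have G1: "1 \<le> G" by (simp add: heat_def)
  have heat0: "(\<lambda>N. heat r N x) \<longlonglongrightarrow> 0" if x: "x \<in> V" for x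
  proof -
    have "(\<lambda>n. heat r (2 * n) r) \<longlonglongrightarrow> 0"
      using LIMSEQ_subseq_LIMSEQ[OF summable_LIMSEQ_zero[OF sm], of "\<lambda>n. 2 * n"]
      by (simp add: strict_mono_def o_def)
    then have "(\<lambda>n. (heat r n x)\<^sup>2) \<longlonglongrightarrow> 0"
      by (rule tendsto_sandwich[OF _ _ tendsto_const, rotated 2])
         (auto simp: heat_square_le r x)
    then show ?thesis by simp
  qed
  have "1 / (2 * G) \<le> form f f" if fin: "finite {x. f x \<noteq> 0}" and f1: "f r = 1" for f
  proof -
    have f: "f summable_on V"
      by (rule finite_nonzero_values_imp_summable_on) (rule finite_subset[OF _ fin], auto)
    have ip: "ip (heat r N) f = (\<Sum>x\<in>V \<inter> {x. f x \<noteq> 0}. heat r N x * f x)" for N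
    proof -
      have "ip (heat r N) f = (\<Sum>\<^sub>\<infinity>x\<in>V \<inter> {x. f x \<noteq> 0}. heat r N x * f x)"
        unfolding ip_def by (rule infsum_cong_neutral) auto
      then show ?thesis using fin by simp
    qed
    have ip0: "(\<lambda>N. ip (heat r N) f) \<longlonglongrightarrow> 0"
      unfolding ip by (rule tendsto_null_sum) (auto intro!: tendsto_mult_left_zero heat0)
    \<comment> \<open>Any \<open>t < - G / 2\<close> would do; this one keeps the constants simple.\<close>
    let ?t = "- 2 * G"
    have "0 \<le> G + 2 * ?t * (1 - ip (heat r N) f) + ?t\<^sup>2 * form f f" for N
    proof -
      let ?w = "\<lambda>x. green r N x + ?t * f x"
      have "?w summable_on V" by (intro summable_on_add summable_on_cmult_right f green_summable)
      then have "0 \<le> form ?w ?w"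
        using dirichlet_nonneg[of ?w] by (simp add: dirichlet_eq)
      also have "\<dots> = form (green r N) (green r N) + 2 * ?t * form (green r N) f + ?t\<^sup>2 * form f f"
        by (rule form_quadratic[OF green_summable f])
      also have "\<dots> \<le> G + 2 * ?t * (1 - ip (heat r N) f) + ?t\<^sup>2 * form f f"
        using form_green_green_le[OF r, of N] G[of N] form_green[OF r f, of N] f1 by simp
      finally show ?thesis .
    qed
    moreover have "(\<lambda>N. G + 2 * ?t * (1 - ip (heat r N) f) + ?t\<^sup>2 * form f f)
        \<longlonglongrightarrow> G + 2 * ?t * (1 - 0) + ?t\<^sup>2 * form f f"
      by (intro tendsto_intros ip0)
    ultimately have "0 \<le> G + 2 * ?t * (1 - 0) + ?t\<^sup>2 * form f f"
      by (intro LIMSEQ_le_const) auto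
    then have "3 * G \<le> 4 * G * (G * form f f)" by (simp add: power2_eq_square algebra_simps)
    then have "3 \<le> 4 * (G * form f f)" using G1 by simp
    then show ?thesis using G1 by (simp add: field_simps)
  qed
  then have "1 / G \<le> dirichlet f" if "finite {x. f x \<noteq> 0}" "f r = 1" for f
  proof -
    have "f summable_on V"
      by (rule finite_nonzero_values_imp_summable_on) (rule finite_subset[OF _ that(1)], auto)
    then show ?thesis
      using that \<open>\<And>f. finite {x. f x \<noteq> 0} \<Longrightarrow> f r = 1 \<Longrightarrow> 1 / (2 * G) \<le> form f f\<close>[of f]
      by (simp add: dirichlet_eq)
  qed
  then show ?thesis using G1 by (intro exI[of _ "1 / G"]) simp
qed

text \<open>The uniform measures on the sets \<open>J n\<close> form a flow from \<open>x\<close> to infinity. Passing from \<open>J n\<close> to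
\<open>J (n + 1)\<close> changes the average of \<open>u\<close> by the average of the \<open>2\<^sup>n\<close> differences along the edges from
\<open>y\<close> to \<open>\<phi> n y\<close>; by the Cauchy--Schwarz inequality its square is at most of order
\<open>D(u) / (2r)\<^sup>n\<close>, which is summable after taking roots exactly if \<open>r > 1/2\<close>. The averages tend to 0 since
\<open>u\<close> is summable.\<close>

lemma transient_if_doubling:
  fixes J :: "nat \<Rightarrow> 's set" and \<phi> :: "nat \<Rightarrow> 's \<Rightarrow> 's"
  assumes J0: "J 0 = {x}" and JS: "\<And>n. J (Suc n) = J n \<union> \<phi> n ` J n"
    and JV: "\<And>n. J n \<subseteq> V" and inj: "\<And>n. inj_on (\<phi> n) (J n)"
    and disj: "\<And>n. J n \<inter> \<phi> n ` J n = {}"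
    and P: "\<And>n y. y \<in> J n \<Longrightarrow> \<kappa> * r ^ n \<le> P y (\<phi> n y)"
    and \<kappa>: "0 < \<kappa>" and r: "1 / 2 < r"
  shows "summable (\<lambda>n. kernel_power V P n x x)"
proof (rule summable_heat_if_dirichlet_bound)
  show "x \<in> V" using JV[of 0] J0 by simp
  define q where "q = sqrt (1 / (2 * r))"
  have q: "0 < q" "q < 1" using r by (simp_all add: q_def)
  have q2: "(q ^ n)\<^sup>2 = 1 / (2 ^ n * r ^ n)" for n
  proof -
    have "(q ^ n)\<^sup>2 = (q\<^sup>2) ^ n" by (simp add: power_mult[symmetric] mult.commute)
    also have "q\<^sup>2 = 1 / (2 * r)" using r by (simp add: q_def)
    finally show ?thesis by (simp add: power_divide power_mult_distrib)
  qed
  have J: "finite (J n) \<and> card (J n) = 2 ^ n" for n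
  proof (induction n)
    case 0
    show ?case by (simp add: J0)
  next
    case (Suc n)
    then show ?case using card_Un_disjoint[of "J n" "\<phi> n ` J n"] disj[of n] card_image[OF inj[of n]]
      by (simp add: JS)
  qed
  fix u :: "'s \<Rightarrow> real" assume u: "u summable_on V"
  define D where "D = dirichlet u"
  have D0: "0 \<le> D" by (simp add: D_def dirichlet_nonneg)
  define a where "a n = (\<Sum>y\<in>J n. u y) / 2 ^ n" for n
  have step: "\<bar>a n - a (Suc n)\<bar> \<le> sqrt (D / \<kappa>) * q ^ n" for n
  proof -
    have fin: "finite (J n)" using J by simp
    have "(\<Sum>y\<in>J (Suc n). u y) = (\<Sum>y\<in>J n. u y) + (\<Sum>y\<in>J n. u (\<phi> n y))"
      unfolding JS using fin disj[of n] inj[of n]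
      by (simp add: sum.union_disjoint sum.reindex)
    then have diff: "a n - a (Suc n) = (\<Sum>y\<in>J n. u y - u (\<phi> n y)) / 2 ^ Suc n"
      by (simp add: a_def sum_subtractf field_simps)
    define S where "S = (\<Sum>y\<in>J n. (u y - u (\<phi> n y))\<^sup>2)"
    have S0: "0 \<le> S" unfolding S_def by (intro sum_nonneg) simp
    have "(\<Sum>y\<in>J n. u y - u (\<phi> n y))\<^sup>2 \<le> 2 ^ n * S"
      using Cauchy_Schwarz_ineq_sum[of "\<lambda>_. 1" "\<lambda>y. u y - u (\<phi> n y)" "J n"] J[of n]
      by (simp add: S_def)
    then have "(a n - a (Suc n))\<^sup>2 \<le> 2 ^ n * S / (2 ^ Suc n)\<^sup>2"
      unfolding diff by (simp only: power_divide) (rule divide_right_mono, simp_all)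
    also have "\<dots> = S / (4 * 2 ^ n)" by (simp add: power2_eq_square field_simps)
    also have "\<dots> \<le> S / 2 ^ n" using S0 by (intro divide_left_mono) simp_all
    finally have aS: "(a n - a (Suc n))\<^sup>2 \<le> S / 2 ^ n" .
    have "\<kappa> * r ^ n * S = (\<Sum>y\<in>J n. (\<kappa> * r ^ n) * (u y - u (\<phi> n y))\<^sup>2)"
      by (simp add: S_def sum_distrib_left)
    also have "\<dots> \<le> (\<Sum>y\<in>J n. P y (\<phi> n y) * (u y - u (\<phi> n y))\<^sup>2)"
      by (intro sum_mono mult_right_mono P) simp_all
    also have "\<dots> = (\<Sum>(y, z)\<in>(\<lambda>y. (y, \<phi> n y)) ` J n. P y z * (u y - u z)\<^sup>2)"
      by (subst sum.reindex) (auto intro: inj_onI)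
    also have "\<dots> \<le> D"
      unfolding D_def using JV[of n] JV[of "Suc n"] JS[of n] fin
      by (intro finite_sum_le_dirichlet u) auto
    finally have "S \<le> D / (\<kappa> * r ^ n)" using \<kappa> r by (simp add: field_simps)
    then have "S / 2 ^ n \<le> D / (\<kappa> * r ^ n) / 2 ^ n" by (rule divide_right_mono) simp
    also have "\<dots> = D / \<kappa> * (q ^ n)\<^sup>2" by (simp add: q2)
    finally have "(a n - a (Suc n))\<^sup>2 \<le> D / \<kappa> * (q ^ n)\<^sup>2" using aS by linarith
    then have "sqrt ((a n - a (Suc n))\<^sup>2) \<le> sqrt (D / \<kappa> * (q ^ n)\<^sup>2)" by (rule real_sqrt_le_mono)
    also have "\<dots> = sqrt (D / \<kappa>) * q ^ n"
      using q by (simp only: real_sqrt_mult real_sqrt_abs abs_power2) simp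
    finally show ?thesis by simp
  qed
  \<comment> \<open>The geometric series of the increments bounds the distance between any average and the first one.\<close>
  have tele: "\<bar>a 0\<bar> \<le> \<bar>a N\<bar> + sqrt (D / \<kappa>) / (1 - q)" for N
  proof -
    have "\<bar>a 0\<bar> \<le> \<bar>a N\<bar> + (\<Sum>n<N. sqrt (D / \<kappa>) * q ^ n)"
    proof (induction N)
      case (Suc N)
      then show ?case using step[of N] by simp
    qed simp
    also have "(\<Sum>n<N. sqrt (D / \<kappa>) * q ^ n) = sqrt (D / \<kappa>) * ((1 - q ^ N) / (1 - q))"
      using q by (simp add: sum_distrib_left[symmetric] sum_gp_strict)
    also have "\<dots> \<le> sqrt (D / \<kappa>) * (1 / (1 - q))"
      using q D0 \<kappa> by (intro mult_left_mono divide_right_mono) simp_all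
    finally show ?thesis by simp
  qed
  have "(\<lambda>N. \<bar>a N\<bar>) \<longlonglongrightarrow> 0"
  proof (rule tendsto_sandwich[OF _ _ tendsto_const])
    let ?B = "\<Sum>\<^sub>\<infinity>y\<in>V. \<bar>u y\<bar>"
    have sm: "(\<lambda>y. \<bar>u y\<bar>) summable_on V"
      using u summable_on_iff_abs_summable_on_real[of u V] by simp
    have "\<bar>a N\<bar> \<le> ?B * (1 / 2) ^ N" for N
    proof -
      have "\<bar>\<Sum>y\<in>J N. u y\<bar> \<le> (\<Sum>y\<in>J N. \<bar>u y\<bar>)" by (rule sum_abs)
      also have "\<dots> \<le> ?B" using J[of N] JV[of N] by (intro finite_sum_le_infsum sm) auto
      finally show ?thesis by (simp add: a_def abs_divide power_divide divide_right_mono)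
    qed
    then show "\<forall>\<^sub>F N in sequentially. \<bar>a N\<bar> \<le> ?B * (1 / 2) ^ N" by simp
    show "(\<lambda>N. ?B * (1 / 2) ^ N) \<longlonglongrightarrow> 0"
      by (intro tendsto_mult_right_zero LIMSEQ_realpow_zero) simp_all
  qed simp
  then have "(\<lambda>N. \<bar>a N\<bar> + sqrt (D / \<kappa>) / (1 - q)) \<longlonglongrightarrow> 0 + sqrt (D / \<kappa>) / (1 - q)"
    by (intro tendsto_intros)
  then have "\<bar>a 0\<bar> \<le> 0 + sqrt (D / \<kappa>) / (1 - q)"
    by (rule LIMSEQ_le_const) (use tele in auto)
  moreover have "a 0 = u x" by (simp add: a_def J0)
  ultimately have "\<bar>u x\<bar> \<le> sqrt (D / \<kappa>) / (1 - q)" by simp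
  then have "\<bar>u x\<bar>\<^sup>2 \<le> (sqrt (D / \<kappa>) / (1 - q))\<^sup>2" by (rule power_mono) simp
  then show "(u x)\<^sup>2 \<le> (1 / (\<kappa> * (1 - q)\<^sup>2)) * dirichlet u"
    using D0 \<kappa> by (simp add: power_divide D_def[symmetric])
qed

end

section \<open>Words acting on rays\<close>

text \<open>Rays are functions on the naturals; \<open>case_nat\<close> prepends a letter.\<close>

abbreviation ray_cons :: "bool \<Rightarrow> (nat \<Rightarrow> bool) \<Rightarrow> nat \<Rightarrow> bool" (infixr \<open>\<triangleright>\<close> 65) where
  "i \<triangleright> \<xi> \<equiv> case_nat i \<xi>"

lemma ray_cases:
  obtains i \<zeta> where "\<xi> = i \<triangleright> \<zeta>"
proof
  show "\<xi> = \<xi> 0 \<triangleright> (\<lambda>n. \<xi> (Suc n))" by (auto simp: fun_eq_iff split: nat.split)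
qed

lemma ray_cons_inject [simp]: "i \<triangleright> \<xi> = j \<triangleright> \<zeta> \<longleftrightarrow> i = j \<and> \<xi> = \<zeta>"
  by (auto simp: fun_eq_iff split: nat.splits)

lemma map_ray_cons: "map (i \<triangleright> \<xi>) [0..<Suc n] = i # map \<xi> [0..<n]"
proof -
  have "[0..<Suc n] = 0 # map Suc [0..<n]" by (metis map_Suc_upt upt_conv_Cons zero_less_Suc)
  then show ?thesis by (simp add: comp_def del: upt_Suc)
qed

text \<open>Words over an abstract alphabet, so that weights, sections and substitutions can be defined
by recursion. As the action is from the right, the first letter of a word acts first.\<close>

datatype letter = A | B | C | D

fun letter_map :: "letter \<Rightarrow> bool list \<Rightarrow> bool list" where
  "letter_map A = gr_a"
| "letter_map B = gr_b"
| "letter_map C = gr_c"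
| "letter_map D = gr_d"

definition letter_act :: "letter \<Rightarrow> (nat \<Rightarrow> bool) \<Rightarrow> nat \<Rightarrow> bool" where
  "letter_act s = boundary_action (letter_map s)"

definition act :: "letter list \<Rightarrow> (nat \<Rightarrow> bool) \<Rightarrow> nat \<Rightarrow> bool" where
  "act w = fold letter_act w"

lemma act_Nil [simp]: "act [] \<xi> = \<xi>"
  and act_Cons [simp]: "act (s # w) \<xi> = act w (letter_act s \<xi>)"
  and act_append [simp]: "act (v @ w) \<xi> = act w (act v \<xi>)"
  by (simp_all add: act_def)

lemma boundary_action_wreath:
  "boundary_action (wreath g h \<tau>) (i \<triangleright> \<xi>) = \<tau> i \<triangleright> boundary_action (if i then h else g) \<xi>"
proof
  fix n
  show "boundary_action (wreath g h \<tau>) (i \<triangleright> \<xi>) n = (\<tau> i \<triangleright> boundary_action (if i then h else g) \<xi>) n"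
    unfolding boundary_action_def map_ray_cons
    by (cases n) (simp_all add: wreath_def del: upt_Suc)
qed

lemma boundary_action_id [simp]: "boundary_action id \<xi> = \<xi>"
  by (simp add: boundary_action_def fun_eq_iff nth_append)

lemma letter_act_ray_cons [simp]:
  "letter_act A (i \<triangleright> \<xi>) = (\<not> i) \<triangleright> \<xi>"
  "letter_act B (i \<triangleright> \<xi>) = i \<triangleright> letter_act (if i then C else A) \<xi>"
  "letter_act C (i \<triangleright> \<xi>) = i \<triangleright> letter_act (if i then D else A) \<xi>"
  "letter_act D (i \<triangleright> \<xi>) = i \<triangleright> (if i then letter_act B \<xi> else \<xi>)"
  unfolding letter_act_def letter_map.simps
  by (subst gr_a_def gr_b_wreath gr_c_wreath gr_d_wreath, simp add: boundary_action_wreath)+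

text \<open>Two rays are equal if all their prefixes agree. Induction on the length of the prefix replaces
coinduction, the generators being defined by mutual recursion through their sections.\<close>

definition agree :: "nat \<Rightarrow> (nat \<Rightarrow> bool) \<Rightarrow> (nat \<Rightarrow> bool) \<Rightarrow> bool" where
  "agree n \<xi> \<zeta> \<longleftrightarrow> (\<forall>k<n. \<xi> k = \<zeta> k)"

lemma agree_simps [simp]:
  "agree 0 \<xi> \<zeta>" "agree n \<xi> \<xi>"
  "agree (Suc n) (i \<triangleright> \<xi>) (j \<triangleright> \<zeta>) \<longleftrightarrow> i = j \<and> agree n \<xi> \<zeta>"
  by (simp_all add: agree_def All_less_Suc2)

lemma ray_eqI: "(\<And>n. agree n \<xi> \<zeta>) \<Longrightarrow> \<xi> = \<zeta>"
  by (rule ext) (auto simp: agree_def)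

text \<open>The generators are involutions, and \<open>b\<close>, \<open>c\<close>, \<open>d\<close> are the nontrivial elements of a Klein
four-group. All relations must be proved at once because each one holds on the sections of another.\<close>

lemma letter_relations_agree:
  "agree n (letter_act A (letter_act A \<xi>)) \<xi> \<and> agree n (letter_act B (letter_act B \<xi>)) \<xi> \<and>
   agree n (letter_act C (letter_act C \<xi>)) \<xi> \<and> agree n (letter_act D (letter_act D \<xi>)) \<xi> \<and>
   agree n (letter_act B (letter_act C \<xi>)) (letter_act D \<xi>) \<and> agree n (letter_act C (letter_act B \<xi>)) (letter_act D \<xi>) \<and>
   agree n (letter_act B (letter_act D \<xi>)) (letter_act C \<xi>) \<and> agree n (letter_act D (letter_act B \<xi>)) (letter_act C \<xi>) \<and>
   agree n (letter_act C (letter_act D \<xi>)) (letter_act B \<xi>) \<and> agree n (letter_act D (letter_act C \<xi>)) (letter_act B \<xi>)"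
proof (induction n arbitrary: \<xi>)
  case (Suc n)
  obtain i \<zeta> where \<xi>: "\<xi> = i \<triangleright> \<zeta>" by (rule ray_cases)
  show ?case using Suc.IH[of \<zeta>] by (cases i) (simp_all add: \<xi>)
qed simp

lemma letter_act_BC: "letter_act B (letter_act C \<xi>) = letter_act D \<xi>" and letter_act_CB: "letter_act C (letter_act B \<xi>) = letter_act D \<xi>"
  and letter_act_BD: "letter_act B (letter_act D \<xi>) = letter_act C \<xi>" and letter_act_DB: "letter_act D (letter_act B \<xi>) = letter_act C \<xi>"
  and letter_act_CD: "letter_act C (letter_act D \<xi>) = letter_act B \<xi>" and letter_act_DC: "letter_act D (letter_act C \<xi>) = letter_act B \<xi>"
  by (rule ray_eqI, simp add: letter_relations_agree)+

lemma letter_act_involution [simp]: "letter_act s (letter_act s \<xi>) = \<xi>"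
  by (rule ray_eqI, cases s) (simp_all add: letter_relations_agree)

lemma act_rev_act [simp]: "act (rev w) (act w \<xi>) = \<xi>"
  by (induction w arbitrary: \<xi>) simp_all

lemma inj_act: "inj (act w)"
  by (metis act_rev_act injI)

section \<open>Crossings\<close>

definition ones_from :: "nat \<Rightarrow> (nat \<Rightarrow> bool) set" where
  "ones_from n = {\<xi>. \<forall>i\<ge>n. \<xi> i}"

lemma ones_from_0: "ones_from 0 = {\<lambda>_. True}"
  by (auto simp: ones_from_def)

lemma ray_cons_True: "True \<triangleright> (\<lambda>_. True) = (\<lambda>_. True)"
  by (auto simp: fun_eq_iff split: nat.split)

lemma ray_cons_in_ones_from [simp]: "i \<triangleright> \<xi> \<in> ones_from (Suc n) \<longleftrightarrow> \<xi> \<in> ones_from n"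
proof
  assume "i \<triangleright> \<xi> \<in> ones_from (Suc n)"
  then have "\<forall>k\<ge>n. (i \<triangleright> \<xi>) (Suc k)" unfolding ones_from_def by blast
  then show "\<xi> \<in> ones_from n" by (simp add: ones_from_def)
qed (auto simp: ones_from_def split: nat.split)

lemma ones_from_Suc: "ones_from (Suc n) = ray_cons False ` ones_from n \<union> ray_cons True ` ones_from n"
proof (rule Set.set_eqI, rule iffI)
  fix \<xi> assume "\<xi> \<in> ones_from (Suc n)"
  then show "\<xi> \<in> ray_cons False ` ones_from n \<union> ray_cons True ` ones_from n"
    by (cases \<xi> rule: ray_cases) (auto simp: image_iff)
qed auto

lemma ones_from_mono: "m \<le> n \<Longrightarrow> ones_from m \<subseteq> ones_from n"
  by (auto simp: ones_from_def)

lemma finite_ones_from: "finite (ones_from n)"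
  by (induction n) (simp_all add: ones_from_0 ones_from_Suc)

lemma card_ones_from: "card (ones_from n) \<le> 2 ^ n"
proof (induction n)
  case (Suc n)
  have "card (ones_from (Suc n)) \<le> card (ray_cons False ` ones_from n) + card (ray_cons True ` ones_from n)"
    unfolding ones_from_Suc by (rule card_Un_le)
  also have "\<dots> \<le> card (ones_from n) + card (ones_from n)"
    by (intro add_mono card_image_le finite_ones_from)
  finally show ?case using Suc by simp
qed (simp add: ones_from_0)

lemma letter_act_ones:
  "letter_act B (\<lambda>_. True) = (\<lambda>_. True)" "letter_act C (\<lambda>_. True) = (\<lambda>_. True)" "letter_act D (\<lambda>_. True) = (\<lambda>_. True)"
proof -
  define \<omega> :: "nat \<Rightarrow> bool" where "\<omega> = (\<lambda>_. True)"
  have \<omega>: "\<omega> = True \<triangleright> \<omega>" unfolding \<omega>_def by (rule ray_cons_True[symmetric])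
  have unfold: "letter_act B \<omega> = True \<triangleright> letter_act C \<omega>" "letter_act C \<omega> = True \<triangleright> letter_act D \<omega>" "letter_act D \<omega> = True \<triangleright> letter_act B \<omega>"
    by (subst (1) \<omega>, simp)+
  have "agree n (letter_act B \<omega>) \<omega> \<and> agree n (letter_act C \<omega>) \<omega> \<and> agree n (letter_act D \<omega>) \<omega>" for n
  proof (induction n)
    case (Suc n)
    have "agree (Suc n) (True \<triangleright> letter_act C \<omega>) (True \<triangleright> \<omega>) \<and> agree (Suc n) (True \<triangleright> letter_act D \<omega>) (True \<triangleright> \<omega>) \<and>
        agree (Suc n) (True \<triangleright> letter_act B \<omega>) (True \<triangleright> \<omega>)"
      using Suc by simp
    then show ?case by (simp only: unfold[symmetric] \<omega>[symmetric])
  qed simp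
  then show "letter_act B (\<lambda>_. True) = (\<lambda>_. True)" "letter_act C (\<lambda>_. True) = (\<lambda>_. True)"
    "letter_act D (\<lambda>_. True) = (\<lambda>_. True)"
    unfolding \<omega>_def[symmetric] by (auto intro: ray_eqI)
qed

text \<open>In the Schreier graph, which is a half-line, a generator moves a point by at most one step, and
leaving \<open>I\<^sub>k\<close> it lands in \<open>I\<^bsub>k+1\<^esub>\<close>.\<close>

lemma letter_act_ones_from: "\<xi> \<in> ones_from k \<Longrightarrow> letter_act s \<xi> \<in> ones_from (Suc k)"
proof (induction k arbitrary: \<xi> s)
  case 0
  have "letter_act A (True \<triangleright> (\<lambda>_. True)) \<in> ones_from (Suc 0)" by (simp add: ones_from_0)
  then have "letter_act A (\<lambda>_. True) \<in> ones_from (Suc 0)" by (simp only: ray_cons_True)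
  then show ?case using 0
    by (cases s) (auto simp: ones_from_0 letter_act_ones ones_from_def)
next
  case (Suc k)
  obtain i \<zeta> where \<xi>: "\<xi> = i \<triangleright> \<zeta>" by (rule ray_cases)
  show ?case using Suc.IH[of \<zeta>] Suc.prems ones_from_mono[of k "Suc k"] by (cases s) (auto simp: \<xi>)
qed

lemma act_ones_from: "\<xi> \<in> ones_from k \<Longrightarrow> act w \<xi> \<in> ones_from (k + length w)"
proof (induction w arbitrary: \<xi> k)
  case (Cons s w)
  then show ?case using letter_act_ones_from[of \<xi> k s] by fastforce
qed simp

definition crossings :: "nat \<Rightarrow> letter list \<Rightarrow> nat" where
  "crossings n w = card {\<xi> \<in> ones_from n. act w \<xi> \<notin> ones_from n}"

lemma crossings_le_power: "crossings n w \<le> 2 ^ n"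
  using card_mono[OF finite_ones_from, of "{\<xi> \<in> ones_from n. act w \<xi> \<notin> ones_from n}" n] card_ones_from[of n]
  unfolding crossings_def by auto

lemma crossings_Cons_le: "crossings n (s # w) \<le> crossings n [s] + crossings n w"
proof -
  let ?X = "{\<xi> \<in> ones_from n. letter_act s \<xi> \<in> ones_from n \<and> act w (letter_act s \<xi>) \<notin> ones_from n}"
  have "crossings n (s # w) \<le> card ({\<xi> \<in> ones_from n. act [s] \<xi> \<notin> ones_from n} \<union> ?X)"
    unfolding crossings_def by (rule card_mono) (auto simp: finite_ones_from)
  also have "\<dots> \<le> crossings n [s] + card ?X"
    unfolding crossings_def by (rule card_Un_le)
  also have "card ?X \<le> crossings n w"
    unfolding crossings_def
    by (rule card_inj_on_le[of "letter_act s"]) (auto simp: finite_ones_from intro: inj_on_inverseI[where g = "letter_act s"])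
  finally show ?thesis by simp
qed

fun word_section :: "bool \<Rightarrow> letter list \<Rightarrow> letter list" where
  "word_section i [] = []"
| "word_section i (A # w) = word_section (\<not> i) w"
| "word_section i (B # w) = (if i then C else A) # word_section i w"
| "word_section i (C # w) = (if i then D else A) # word_section i w"
| "word_section i (D # w) = (if i then B # word_section i w else word_section i w)"

lemma act_ray_cons: "\<exists>j. act w (i \<triangleright> \<xi>) = j \<triangleright> act (word_section i w) \<xi>"
  by (induction i w arbitrary: \<xi> rule: word_section.induct) auto

text \<open>\<open>I\<^bsub>n+1\<^esub>\<close> consists of two copies of \<open>I\<^sub>n\<close>, one below each letter, and \<open>w\<close> acts on them through
its sections. This self-similarity carries the contraction over to crossings.\<close>

lemma crossings_Suc: "crossings (Suc n) w = crossings n (word_section False w) + crossings n (word_section True w)"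
proof -
  let ?X = "\<lambda>i. {\<xi> \<in> ones_from n. act (word_section i w) \<xi> \<notin> ones_from n}"
  have in_ones_from: "act w (i \<triangleright> \<xi>) \<in> ones_from (Suc n) \<longleftrightarrow> act (word_section i w) \<xi> \<in> ones_from n" for i \<xi>
    using act_ray_cons[of w i \<xi>] by auto
  have "{\<xi> \<in> ones_from (Suc n). act w \<xi> \<notin> ones_from (Suc n)} = ray_cons False ` ?X False \<union> ray_cons True ` ?X True"
  proof (rule Set.set_eqI)
    fix \<xi>
    obtain i \<zeta> where \<xi>: "\<xi> = i \<triangleright> \<zeta>" by (rule ray_cases)
    show "\<xi> \<in> {\<xi> \<in> ones_from (Suc n). act w \<xi> \<notin> ones_from (Suc n)} \<longleftrightarrow>
        \<xi> \<in> ray_cons False ` ?X False \<union> ray_cons True ` ?X True"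
      by (cases i) (auto simp: \<xi> in_ones_from)
  qed
  moreover have "card (ray_cons False ` ?X False \<union> ray_cons True ` ?X True) =
      card (ray_cons False ` ?X False) + card (ray_cons True ` ?X True)"
    by (rule card_Un_disjoint) (auto simp: finite_ones_from)
  moreover have "card (ray_cons i ` ?X i) = crossings n (word_section i w)" for i
    unfolding crossings_def by (rule card_image) (auto intro: inj_onI)
  ultimately show ?thesis by (simp add: crossings_def)
qed

lemma crossings_Nil [simp]: "crossings n [] = 0"
  by (simp add: crossings_def)

text \<open>A generator crosses the boundary of \<open>I\<^sub>n\<close> in at most one point: \<open>a\<close> does so only for \<open>n = 0\<close>, and for
\<open>b\<close>, \<open>c\<close>, \<open>d\<close> at most one of the two sections crosses.\<close>

lemma crossings_letter: "crossings n [s] \<le> 1"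
proof -
  have A0: "crossings (Suc n) [A] = 0" for n by (simp add: crossings_Suc)
  have "crossings n [A] \<le> 1 \<and> crossings n [B] \<le> 1 \<and> crossings n [C] \<le> 1 \<and> crossings n [D] \<le> 1"
  proof (induction n)
    case 0
    show ?case using crossings_le_power[of 0] by auto
  next
    case (Suc n)
    \<comment> \<open>For \<open>n = 0\<close> only \<open>a\<close> can move the ray of ones, for \<open>n > 0\<close> it does not cross at all.\<close>
    have "crossings n [A] + crossings n [C] \<le> 1 \<and> crossings n [A] + crossings n [D] \<le> 1"
    proof (cases n)
      case 0
      have "{\<xi> \<in> ones_from 0. act [C] \<xi> \<notin> ones_from 0} = {}" "{\<xi> \<in> ones_from 0. act [D] \<xi> \<notin> ones_from 0} = {}"
        by (auto simp: ones_from_0 letter_act_ones)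
      then have "crossings 0 [C] = 0" "crossings 0 [D] = 0" by (simp_all only: crossings_def card.empty)
      then show ?thesis using Suc 0 by simp
    next
      case (Suc k)
      then show ?thesis using Suc.IH A0 by simp
    qed
    then show ?case using Suc by (simp add: crossings_Suc A0)
  qed
  then show ?thesis by (cases s) auto
qed

section \<open>Weights\<close>

lemma lambda0_root: "lambda0 ^ 3 = lambda0\<^sup>2 + 2 * lambda0 + 4"
  and lambda0_pos: "lambda0 > 0"
proof -
  have "lambda0 > 0 \<and> poly [:-4, -2, -1, 1:] lambda0 = 0"
    unfolding lambda0_def by (rule theI'[OF ex1_lambda0])
  then show "lambda0 ^ 3 = lambda0\<^sup>2 + 2 * lambda0 + 4" "lambda0 > 0"
    by (simp_all add: algebra_simps power2_eq_square power3_eq_cube)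
qed

lemma lambda0_gt_2: "lambda0 > 2"
proof (rule ccontr)
  assume "\<not> lambda0 > 2"
  then have le: "lambda0 \<le> 2" by simp
  have "lambda0 ^ 3 \<le> 2 * lambda0\<^sup>2"
    using le lambda0_pos by (simp add: power2_eq_square power3_eq_cube)
  also have "\<dots> \<le> lambda0\<^sup>2 + 2 * lambda0"
    using le lambda0_pos by (simp add: power2_eq_square)
  finally show False using lambda0_root by simp
qed

definition eta :: real where "eta = 2 / lambda0"

lemma eta_pos: "0 < eta" and eta_less_1: "eta < 1"
  using lambda0_gt_2 by (simp_all add: eta_def)

text \<open>This relation is the equation of \<open>\<lambda>\<^sub>0\<close> rewritten for \<open>2 / \<lambda>\<^sub>0\<close>. It is what makes the weights below work.\<close>

lemma eta_root: "eta ^ 3 + eta\<^sup>2 + eta = 2"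
proof -
  have "eta ^ 3 + eta\<^sup>2 + eta = (2 * (lambda0\<^sup>2 + 2 * lambda0 + 4)) / lambda0 ^ 3"
    using lambda0_pos by (simp add: eta_def field_simps power2_eq_square power3_eq_cube)
  then show ?thesis using lambda0_pos by (simp add: lambda0_root[symmetric])
qed

text \<open>Bartholdi's weights. They are chosen so that \<open>\<eta> \<cdot> (|a| + |x|)\<close> is exactly the total weight of the two
sections of \<open>x\<close> for every \<open>x\<close> among \<open>b\<close>, \<open>c\<close>, \<open>d\<close>, and so that replacing \<open>cd\<close> by \<open>b\<close> loses no weight.\<close>

fun letter_weight :: "letter \<Rightarrow> real" where
  "letter_weight A = 1 - eta ^ 3"
| "letter_weight B = eta ^ 3"
| "letter_weight C = 1 - eta\<^sup>2"
| "letter_weight D = 1 - eta"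

definition weight :: "letter list \<Rightarrow> real" where
  "weight w = sum_list (map letter_weight w)"

lemma weight_Nil [simp]: "weight [] = 0" and weight_Cons [simp]: "weight (s # w) = letter_weight s + weight w"
  by (simp_all add: weight_def)

lemma letter_weight_pos: "0 < letter_weight s" and letter_weight_le_1: "letter_weight s \<le> 1"
  using eta_pos eta_less_1 power_less_one_iff[of eta 3] power_less_one_iff[of eta 2] zero_less_power[of eta 3]
  by (cases s; simp)+

lemma weight_le_length: "weight w \<le> length w"
proof (induction w)
  case (Cons s w)
  then show ?case using letter_weight_le_1[of s] by simp
qed simp

lemma letter_weight_B: "letter_weight B = letter_weight C + letter_weight D"
  using eta_root by simp

declare letter_weight.simps [simp del]

lemma crossings_le_weight: "\<exists>K>0. \<forall>n w. real (crossings n w) \<le> K * weight w"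
proof -
  define k where "k = Min (letter_weight ` {A, B, C, D})"
  have "k \<in> letter_weight ` {A, B, C, D}" unfolding k_def by (rule Min_in) auto
  then obtain s where "k = letter_weight s" by blast
  then have k0: "k > 0" using letter_weight_pos[of s] by simp
  have k: "k \<le> letter_weight s" for s
    unfolding k_def by (rule Min_le) (cases s; auto)+
  have "k * real (crossings n w) \<le> weight w" for n w
  proof (induction w)
    case (Cons s w)
    have "real (crossings n (s # w)) \<le> 1 + real (crossings n w)"
      using crossings_Cons_le[of n s w] crossings_letter[of n s] by linarith
    then have "k * real (crossings n (s # w)) \<le> k * (1 + real (crossings n w))"
      using k0 by simp
    also have "\<dots> \<le> weight (s # w)" using Cons k[of s] by (simp add: algebra_simps)
    finally show ?case .
  qed simp
  then show ?thesis using k0 by (intro exI[of _ "1 / k"]) (simp add: field_simps)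
qed

fun alternating :: "letter list \<Rightarrow> bool" where
  "alternating (s # t # w) \<longleftrightarrow> (s = A) \<noteq> (t = A) \<and> alternating (t # w)"
| "alternating _ \<longleftrightarrow> True"

lemma alternating_Cons_hd:
  "alternating (s # w) \<Longrightarrow> alternating w"
  "alternating (s # w) \<Longrightarrow> (s = A) = (t = A) \<Longrightarrow> alternating (t # w)"
  by (cases w; simp)+

text \<open>Adjacent equal letters cancel, and two distinct letters among \<open>b\<close>, \<open>c\<close>, \<open>d\<close> merge into the third, whose
weight is at most the sum of theirs because the three weights satisfy the triangle inequalities.\<close>

lemma exists_alternating: "\<exists>v. alternating v \<and> act v = act w \<and> weight v \<le> weight w"
proof (induction w)
  case Nil
  show ?case by (rule exI[of _ "[]"]) simp
next
  case (Cons s w)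
  then obtain v where v: "alternating v" "act v = act w" "weight v \<le> weight w" by blast
  have act: "act (s # w) = (\<lambda>\<xi>. act v (letter_act s \<xi>))" by (simp add: v fun_eq_iff)
  show ?case
  proof (cases v)
    case Nil
    then show ?thesis using v act by (intro exI[of _ "[s]"]) (auto simp: fun_eq_iff)
  next
    case (Cons t u)
    note alt = v(1)[unfolded Cons]
    have short: ?thesis if "s = t"
      using alternating_Cons_hd(1)[OF alt] v act letter_weight_pos[of t] that
      by (intro exI[of _ u]) (auto simp: Cons fun_eq_iff)
    have merge: ?thesis if "t \<noteq> A" "r \<noteq> A" "letter_weight r \<le> letter_weight s + letter_weight t" "\<And>\<xi>. letter_act t (letter_act s \<xi>) = letter_act r \<xi>" for r
      using alternating_Cons_hd(2)[OF alt, of r] v act that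
      by (intro exI[of _ "r # u"]) (auto simp: Cons fun_eq_iff)
    have long: ?thesis if "(s = A) \<noteq> (t = A)"
      using alt v act that by (intro exI[of _ "s # v"]) (auto simp: Cons fun_eq_iff)
    show ?thesis
    proof (cases "s = t \<or> (s = A) \<noteq> (t = A)")
      case True
      then show ?thesis using short long by blast
    next
      case False
      have le: "letter_weight B \<le> letter_weight C + letter_weight D" "letter_weight C \<le> letter_weight B + letter_weight D" "letter_weight D \<le> letter_weight B + letter_weight C"
        using letter_weight_B letter_weight_pos[of C] letter_weight_pos[of D] by linarith+
      from False consider "s = B" "t = C" | "s = C" "t = B" | "s = B" "t = D" | "s = D" "t = B" |
          "s = C" "t = D" | "s = D" "t = C"
        by (cases s; cases t) simp_all
      then show ?thesis
      proof cases
        case 1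
        show ?thesis by (rule merge[of D]) (use le in \<open>simp_all add: 1 letter_act_CB\<close>)
      next
        case 2
        show ?thesis by (rule merge[of D]) (use le in \<open>simp_all add: 2 letter_act_BC\<close>)
      next
        case 3
        show ?thesis by (rule merge[of C]) (use le in \<open>simp_all add: 3 letter_act_DB\<close>)
      next
        case 4
        show ?thesis by (rule merge[of C]) (use le in \<open>simp_all add: 4 letter_act_BD\<close>)
      next
        case 5
        show ?thesis by (rule merge[of B]) (use le in \<open>simp_all add: 5 letter_act_DC\<close>)
      next
        case 6
        show ?thesis by (rule merge[of B]) (use le in \<open>simp_all add: 6 letter_act_CD\<close>)
      qed
    qed
  qed
qed

text \<open>A letter \<open>a\<close> only exchanges the two sections and leaves no trace in them; every other letter
contributes its own two sections.\<close>

lemma weight_word_section: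
  "weight (word_section False w) + weight (word_section True w) = (\<Sum>s\<leftarrow>w. if s = A then 0 else eta * (letter_weight A + letter_weight s))"
proof (induction w)
  case (Cons s w)
  have "1 - eta ^ 3 + (1 - eta\<^sup>2) = eta" "1 - eta ^ 3 + (1 - eta) = eta\<^sup>2"
    using eta_root by simp_all
  then have e: "eta * (1 - eta ^ 3 + (1 - eta\<^sup>2)) = 1 - eta ^ 3 + (1 - eta)"
    "eta * (1 - eta ^ 3 + (1 - eta)) = eta ^ 3"
    "eta * (1 - eta ^ 3 + eta ^ 3) = 1 - eta ^ 3 + (1 - eta\<^sup>2)"
    by (simp_all only: power2_eq_square power3_eq_cube mult.assoc) simp
  show ?case using Cons e by (cases s) (simp_all add: letter_weight.simps)
qed simp

text \<open>In an alternating word each letter other than \<open>a\<close>, except possibly one, can be charged together with an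
adjacent \<open>a\<close>; the additive constant pays for the exception.\<close>

lemma weight_word_section_alternating:
  assumes "alternating w"
  shows "weight (word_section False w) + weight (word_section True w) \<le> eta * (weight w + letter_weight A)"
proof -
  \<comment> \<open>The strengthened claim says that no exception occurs if the word begins with \<open>a\<close>.\<close>
  define h where "h w = (\<Sum>s\<leftarrow>w. if s = A then 0 else eta * (letter_weight A + letter_weight s))" for w
  have "h w \<le> eta * (weight w + letter_weight A) \<and> (w = [] \<or> hd w = A \<longrightarrow> h w \<le> eta * weight w)"
    using assms
  proof (induction w)
    case Nil
    show ?case using eta_pos letter_weight_pos[of A] by (simp add: h_def)
  next
    case (Cons s w)
    note IH = Cons.IH[OF alternating_Cons_hd(1)[OF Cons.prems]]
    show ?case
    proof (cases "s = A")
      case True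
      have "h w \<le> eta * (weight w + letter_weight A)" using IH by simp
      also have "\<dots> = eta * weight (s # w)" using True by simp
      also have "\<dots> \<le> eta * (weight (s # w) + letter_weight A)" using eta_pos letter_weight_pos[of A] by simp
      finally show ?thesis using IH True by (simp add: h_def algebra_simps)
    next
      case False
      then have "w = [] \<or> hd w = A" using Cons.prems by (cases w) auto
      then have "h w \<le> eta * weight w" using IH by simp
      then show ?thesis using False by (simp add: h_def algebra_simps)
    qed
  qed
  then show ?thesis by (simp add: weight_word_section h_def)
qed

text \<open>Iterating the contraction over \<open>m\<close> levels, where the \<open>2\<^sup>m\<close> additive constants appear.\<close>

lemma crossings_contraction:
  "\<exists>K>0. \<forall>m n w. m \<le> n \<longrightarrow> real (crossings n w) \<le> K * (eta ^ m * weight w + 2 ^ m)"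
proof -
  obtain K where K: "K > 0" "\<And>n w. real (crossings n w) \<le> K * weight w" using crossings_le_weight by blast
  \<comment> \<open>The average weight per section that the contraction leaves fixed: \<open>\<eta> (t + |a|) = 2 t\<close>. Measured
    from \<open>t\<close>, the total weight shrinks by exactly \<open>\<eta>\<close> per level.\<close>
  define t where "t = eta * letter_weight A / (2 - eta)"
  have t: "eta * letter_weight A - 2 * t = - eta * t"
    using eta_less_1 by (simp add: t_def field_simps)
  have t0: "0 \<le> t" unfolding t_def using eta_pos eta_less_1 letter_weight_pos[of A] by simp
  have "eta * letter_weight A \<le> 1 * 1"
    using eta_pos eta_less_1 letter_weight_pos[of A] letter_weight_le_1[of A] by (intro mult_mono) auto
  then have t1: "t \<le> 1" unfolding t_def using eta_less_1 by simp
  have main: "real (crossings n w) \<le> K * (eta ^ m * (weight w - t) + t * 2 ^ m)" if "m \<le> n" for m n w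
    using that
  proof (induction m arbitrary: n w)
    case 0
    then show ?case using K(2)[of n w] by simp
  next
    case (Suc m)
    then obtain k where n: "n = Suc k" "m \<le> k" by (cases n) auto
    obtain v where v: "alternating v" "act v = act w" "weight v \<le> weight w"
      using exists_alternating by blast
    have "real (crossings n w) = real (crossings k (word_section False v)) + real (crossings k (word_section True v))"
      using crossings_Suc[of k v] v(2) by (simp add: n crossings_def)
    also have "\<dots> \<le> K * (eta ^ m * (weight (word_section False v) - t) + t * 2 ^ m) +
        K * (eta ^ m * (weight (word_section True v) - t) + t * 2 ^ m)"
      by (intro add_mono Suc.IH n)
    also have "\<dots> = K * (eta ^ m * (weight (word_section False v) + weight (word_section True v) - 2 * t) + t * 2 ^ Suc m)"
      by (simp add: algebra_simps)
    also have "\<dots> \<le> K * (eta ^ m * (eta * (weight w + letter_weight A) - 2 * t) + t * 2 ^ Suc m)"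
    proof -
      have "weight (word_section False v) + weight (word_section True v) \<le> eta * (weight w + letter_weight A)"
        using weight_word_section_alternating[OF v(1)] v(3) eta_pos
        by (smt (verit) mult_left_mono)
      then show ?thesis using K(1) eta_pos by simp
    qed
    also have "eta * (weight w + letter_weight A) - 2 * t = eta * (weight w - t)"
      using t by (simp add: algebra_simps)
    finally show ?case by (simp add: mult.assoc mult.commute[of "eta ^ m"])
  qed
  have "real (crossings n w) \<le> K * (eta ^ m * weight w + 2 ^ m)" if "m \<le> n" for m n w
  proof -
    have "eta ^ m * (weight w - t) + t * 2 ^ m \<le> eta ^ m * weight w + 1 * 2 ^ m"
      using t0 t1 eta_pos by (intro add_mono mult_left_mono mult_right_mono) auto
    then show ?thesis using main[OF that, of w] K(1) by (smt (verit) mult_left_mono)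
  qed
  then show ?thesis using K(1) by blast
qed

definition alpha0 :: real where "alpha0 = ln 2 / ln lambda0"

lemma alpha0_pos: "alpha0 > 0"
  using lambda0_gt_2 by (simp add: alpha0_def)

lemma lambda0_powr_alpha0: "lambda0 powr alpha0 = 2"
  using lambda0_gt_2 by (simp add: alpha0_def powr_def)

lemma lambda0_power_powr: "(lambda0 ^ m) powr alpha0 = 2 ^ m"
  using lambda0_pos lambda0_powr_alpha0
  by (metis powr_powr mult.commute powr_realpow zero_less_numeral)

text \<open>Take \<open>m\<close> least with \<open>\<lambda>\<^sub>0\<^sup>m \<ge> l\<close>. If \<open>m \<le> n\<close> then the contraction applies and \<open>\<eta>\<^sup>m l \<le> 2\<^sup>m\<close>; otherwise already
\<open>I\<^sub>n\<close> has at most \<open>2\<^sup>m\<close> points. Minimality gives \<open>2\<^sup>m \<le> 2 l\<^sup>\<alpha>\<close>.\<close>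

lemma crossings_le_length_powr:
  "\<exists>K>0. \<forall>n w. real (crossings n w) \<le> K * real (length w) powr alpha0"
proof -
  obtain K where K: "K > 0" "\<And>m n w. m \<le> n \<Longrightarrow> real (crossings n w) \<le> K * (eta ^ m * weight w + 2 ^ m)"
    using crossings_contraction by blast
  have "real (crossings n w) \<le> (4 * K + 2) * real (length w) powr alpha0" for n w
  proof (cases "w = []")
    case False
    then have L: "1 \<le> real (length w)" by (cases w) auto
    define m where "m = (LEAST m. real (length w) \<le> lambda0 ^ m)"
    have ex: "\<exists>m. real (length w) \<le> lambda0 ^ m"
      using real_arch_pow[of lambda0 "real (length w)"] lambda0_gt_2 by (auto intro: less_imp_le)
    have m: "real (length w) \<le> lambda0 ^ m"
      unfolding m_def by (rule LeastI_ex[OF ex])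
    have "lambda0 ^ m \<le> lambda0 * real (length w)"
    proof (cases m)
      case 0
      then show ?thesis using L lambda0_gt_2 mult_mono[of 1 lambda0 1 "real (length w)"] by simp
    next
      case (Suc k)
      then have "\<not> real (length w) \<le> lambda0 ^ k"
        using not_less_Least[of k "\<lambda>m. real (length w) \<le> lambda0 ^ m"] by (simp add: m_def)
      then show ?thesis using Suc lambda0_gt_2 by simp
    qed
    then have "(lambda0 ^ m) powr alpha0 \<le> (lambda0 * real (length w)) powr alpha0"
      using lambda0_pos alpha0_pos by (intro powr_mono2) auto
    then have 2: "2 ^ m \<le> 2 * real (length w) powr alpha0"
      using lambda0_pos by (simp add: lambda0_power_powr powr_mult lambda0_powr_alpha0)
    have "real (crossings n w) \<le> (2 * K + 1) * 2 ^ m"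
    proof (cases "m \<le> n")
      case True
      have "eta ^ m * weight w \<le> eta ^ m * lambda0 ^ m"
        using weight_le_length[of w] m eta_pos by (intro mult_left_mono) auto
      also have "\<dots> = 2 ^ m" using lambda0_pos by (simp add: eta_def power_divide)
      finally have "K * (eta ^ m * weight w + 2 ^ m) \<le> K * (2 ^ m + 2 ^ m)" using K(1) by simp
      then have "real (crossings n w) \<le> K * (2 ^ m + 2 ^ m)"
        using K(2)[OF True, of w] by linarith
      also have "\<dots> \<le> (2 * K + 1) * 2 ^ m" by (simp add: algebra_simps)
      finally show ?thesis .
    next
      case False
      have "real (crossings n w) \<le> real (2 ^ n)"
        using crossings_le_power[of n w] by (simp only: of_nat_le_iff)
      also have "\<dots> \<le> 1 * 2 ^ m" using False by simp
      also have "\<dots> \<le> (2 * K + 1) * 2 ^ m" using K(1) by (intro mult_right_mono) auto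
      finally show ?thesis .
    qed
    also have "\<dots> \<le> (2 * K + 1) * (2 * real (length w) powr alpha0)"
      using 2 K(1) by (intro mult_left_mono) auto
    finally show ?thesis by (simp add: algebra_simps)
  qed simp
  then show ?thesis using K(1) by (intro exI[of _ "4 * K + 2"]) simp
qed

section \<open>Elements that flip one letter\<close>

definition interleave_A :: "letter list \<Rightarrow> letter list" where
  "interleave_A xs = concat (map (\<lambda>x. [A, x]) xs)"

text \<open>The Lysionok-type substitution \<open>ab \<mapsto> abadac\<close>, \<open>ac \<mapsto> abab\<close>, \<open>ad \<mapsto> acac\<close>, recorded on the letters between
the \<open>a\<close>'s; its value at \<open>a\<close> itself is a default.\<close>

fun letter_substitute :: "letter \<Rightarrow> letter list" where
  "letter_substitute A = []"
| "letter_substitute B = [B, D, C]"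
| "letter_substitute C = [B, B]"
| "letter_substitute D = [C, C]"

definition substitute :: "letter list \<Rightarrow> letter list" where
  "substitute xs = concat (map letter_substitute xs)"

lemma interleave_A_simps [simp]: "interleave_A [] = []" "interleave_A (x # xs) = A # x # interleave_A xs"
    "interleave_A (xs @ ys) = interleave_A xs @ interleave_A ys"
  by (simp_all add: interleave_A_def)

lemma substitute_simps [simp]: "substitute [] = []" "substitute (x # xs) = letter_substitute x @ substitute xs"
  by (simp_all add: substitute_def)

text \<open>Both sections of the substituted word are the original word \<open>w\<close>, up to factors \<open>a\<close> at its ends. An odd
number of \<open>b\<close>'s means an odd number of \<open>a\<close>'s after the substitution, hence an exchange of the two subtrees.
The block \<open>abadac\<close> needs the relation \<open>cd = b\<close>.\<close>

lemma act_interleave_A_substitute: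
  assumes "A \<notin> set xs"
  shows "act (interleave_A (substitute xs)) (False \<triangleright> \<xi>) = (if even (count_list xs B)
      then False \<triangleright> letter_act A (act (interleave_A xs) (letter_act A \<xi>)) else True \<triangleright> act (interleave_A xs) (letter_act A \<xi>))"
    and "act (interleave_A (substitute xs)) (True \<triangleright> \<xi>) = (if even (count_list xs B)
      then True \<triangleright> act (interleave_A xs) \<xi> else False \<triangleright> letter_act A (act (interleave_A xs) \<xi>))"
  using assms
proof (induction xs arbitrary: \<xi>)
  case Nil
  {
    case 1
    then show ?case by simp
  next
    case 2
    then show ?case by simp
  }
next
  case (Cons x xs)
  {
    case 1
    then show ?case using Cons.IH by (cases x) (auto simp: letter_act_DC letter_act_CD)
  next
    case 2
    then show ?case using Cons.IH by (cases x) (auto simp: letter_act_DC letter_act_CD)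
  }
qed

text \<open>The seed \<open>ad\<close> exchanges \<open>1\<^sup>\<infinity>\<close> and \<open>01\<^sup>\<infinity>\<close>. It contains no \<open>b\<close>, and the substitution preserves
the parity of the number of \<open>b\<close>'s, so that every iterate after the seed fixes the first level.\<close>

definition flip_letters :: "nat \<Rightarrow> letter list" where
  "flip_letters n = (substitute ^^ n) [D]"

definition flip_word :: "nat \<Rightarrow> letter list" where
  "flip_word n = interleave_A (flip_letters n)"

lemma flip_letters_Suc: "flip_letters (Suc n) = substitute (flip_letters n)"
  by (simp add: flip_letters_def)

lemma substitute_no_A: "A \<notin> set (substitute xs)"
proof (induction xs)
  case (Cons x xs)
  then show ?case by (cases x) auto
qed simp

lemma count_substitute: "A \<notin> set xs \<Longrightarrow> even (count_list (substitute xs) B) = even (count_list xs B)"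
proof (induction xs)
  case (Cons x xs)
  then show ?case by (cases x) auto
qed simp

lemma flip_letters_props: "A \<notin> set (flip_letters n)" "even (count_list (flip_letters n) B)"
proof (induction n)
  case 0
  {
    case 1
    then show ?case by (simp add: flip_letters_def)
  next
    case 2
    then show ?case by (simp add: flip_letters_def)
  }
next
  case (Suc n)
  {
    case 1
    then show ?case by (simp add: flip_letters_Suc substitute_no_A)
  next
    case 2
    then show ?case using Suc by (simp add: flip_letters_Suc count_substitute)
  }
qed

lemma ray_cons_upd: "(i \<triangleright> \<xi>)(0 := j) = j \<triangleright> \<xi>" "(i \<triangleright> \<xi>)(Suc n := j) = i \<triangleright> (\<xi>(n := j))"
  by (auto simp: fun_eq_iff split: nat.split)

text \<open>By induction both sections of the word flip the letter \<open>n\<close>: one is the previous word, and the other is its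
conjugate by \<open>a\<close>, which has the same effect because flipping the letter \<open>n\<close> commutes with \<open>a\<close>.\<close>

lemma act_flip_word:
  "\<xi> \<in> ones_from (Suc n) \<Longrightarrow> act (flip_word n) \<xi> = \<xi>(n := \<not> \<xi> n)"
proof (induction n arbitrary: \<xi>)
  case 0
  obtain i \<zeta> where \<xi>: "\<xi> = i \<triangleright> \<zeta>" by (rule ray_cases)
  have \<zeta>: "\<zeta> = (\<lambda>_. True)" using 0 by (simp add: \<xi> ones_from_0)
  have "act (flip_word 0) \<xi> = (\<not> i) \<triangleright> \<zeta>"
    by (simp add: flip_word_def flip_letters_def \<xi> \<zeta> letter_act_ones)
  then show ?case by (auto simp: \<xi> fun_eq_iff split: nat.split)
next
  case (Suc n)
  obtain i \<zeta> where \<xi>: "\<xi> = i \<triangleright> \<zeta>" by (rule ray_cases)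
  have \<zeta>: "\<zeta> \<in> ones_from (Suc n)" using Suc.prems by (simp add: \<xi>)
  have IH: "act (flip_word n) \<zeta> = \<zeta>(n := \<not> \<zeta> n)" by (rule Suc.IH[OF \<zeta>])
  have conj: "letter_act A (act (flip_word n) (letter_act A \<zeta>)) = \<zeta>(n := \<not> \<zeta> n)"
  proof -
    obtain j \<omega> where \<omega>: "\<zeta> = j \<triangleright> \<omega>" by (rule ray_cases)
    have "letter_act A \<zeta> \<in> ones_from (Suc n)" using \<zeta> by (simp add: \<omega>)
    then have "act (flip_word n) (letter_act A \<zeta>) = (letter_act A \<zeta>)(n := \<not> letter_act A \<zeta> n)" by (rule Suc.IH)
    also have "\<dots> = letter_act A (\<zeta>(n := \<not> \<zeta> n))"
      by (cases n) (simp_all add: \<omega> ray_cons_upd)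
    finally show ?thesis by simp
  qed
  have "act (flip_word (Suc n)) \<xi> = i \<triangleright> (\<zeta>(n := \<not> \<zeta> n))"
    using act_interleave_A_substitute[OF flip_letters_props(1), of n \<zeta>] flip_letters_props(2)[of n] IH conj
    by (cases i) (simp_all add: flip_word_def flip_letters_Suc \<xi>)
  then show ?case by (auto simp: \<xi> fun_eq_iff split: nat.split)
qed

text \<open>The substitution multiplies the weight \<open>p\<close> by exactly \<open>\<lambda>\<^sub>0\<close>: the values \<open>1\<close>, \<open>\<eta>\<close>, \<open>\<eta>\<^sup>2\<close>, which are the
weights of \<open>ab\<close>, \<open>ac\<close>, \<open>ad\<close>, form an eigenvector of its matrix of letter counts, of which \<open>X\<^sup>3 - X\<^sup>2 - 2X - 4\<close>
is the characteristic polynomial.\<close>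

lemma length_flip_word: "real (length (flip_word n)) \<le> 2 * lambda0 ^ n"
proof -
  define p :: "letter \<Rightarrow> real" where
    "p x = (case x of A \<Rightarrow> 0 | B \<Rightarrow> 1 | C \<Rightarrow> eta | D \<Rightarrow> eta\<^sup>2)" for x
  have lam: "lambda0 * eta = 2" using lambda0_pos by (simp add: eta_def)
  have p_substitute: "(\<Sum>x\<leftarrow>letter_substitute x. p x) = lambda0 * p x" for x
  proof -
    have "lambda0 * (eta ^ 3 + eta\<^sup>2 + eta) = (lambda0 * eta) * (1 + eta + eta\<^sup>2)"
      by (simp add: algebra_simps power2_eq_square power3_eq_cube)
    then have "lambda0 * (eta ^ 3 + eta\<^sup>2 + eta) = 2 * (1 + eta + eta\<^sup>2)"
      by (simp only: lam)
    then have "1 + (eta\<^sup>2 + eta) = lambda0" using eta_root by simp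
    moreover have "lambda0 * eta\<^sup>2 = 2 * eta"
      using lam by (simp add: power2_eq_square flip: mult.assoc)
    ultimately show ?thesis using lam by (cases x) (simp_all add: p_def)
  qed
  have "(\<Sum>x\<leftarrow>substitute xs. p x) = lambda0 * (\<Sum>x\<leftarrow>xs. p x)" for xs
    by (induction xs) (simp_all add: p_substitute algebra_simps)
  then have tot: "(\<Sum>x\<leftarrow>flip_letters n. p x) = lambda0 ^ n * eta\<^sup>2"
    by (induction n) (simp_all add: flip_letters_Suc, simp_all add: flip_letters_def p_def)
  have eta2: "eta\<^sup>2 \<le> eta" "eta\<^sup>2 \<le> 1"
    using eta_pos eta_less_1 by (simp_all add: power2_eq_square power_le_one mult_le_one)
  have "A \<notin> set xs \<Longrightarrow> eta\<^sup>2 * real (length xs) \<le> (\<Sum>x\<leftarrow>xs. p x)" for xs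
  proof (induction xs)
    case (Cons x xs)
    have "eta\<^sup>2 \<le> p x" using Cons.prems eta2 by (cases x) (auto simp: p_def)
    then show ?case using Cons by (simp add: algebra_simps)
  qed simp
  from this[OF flip_letters_props(1)] tot
  have "eta\<^sup>2 * real (length (flip_letters n)) \<le> lambda0 ^ n * eta\<^sup>2" by metis
  then have "real (length (flip_letters n)) \<le> lambda0 ^ n" using eta_pos by simp
  moreover have "length (interleave_A xs) = 2 * length xs" for xs by (induction xs) simp_all
  ultimately show ?thesis by (simp add: flip_word_def)
qed

section \<open>Words as group elements\<close>

text \<open>A tree automorphism maps prefixes to prefixes; hence the boundary action is a right action.\<close>

lemma map_boundary_action:
  assumes "tree_automorphism g"
  shows "map (boundary_action g \<xi>) [0..<n] = g (map \<xi> [0..<n])"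
proof (induction n)
  case 0
  show ?case using assms by (simp add: tree_automorphism_def)
next
  case (Suc n)
  have "child (g (map \<xi> [0..<n])) (g (map \<xi> [0..<Suc n]))"
    using assms by (auto simp: tree_automorphism_def child_def)
  then obtain j where j: "g (map \<xi> [0..<Suc n]) = g (map \<xi> [0..<n]) @ [j]"
    by (auto simp: child_def)
  have "length (g (map \<xi> [0..<n])) = n" using arg_cong[OF Suc, of length] by simp
  then have "boundary_action g \<xi> n = j" unfolding boundary_action_def j by (simp add: nth_append)
  then show ?case using j Suc by simp
qed

lemma boundary_action_comp:
  assumes "tree_automorphism g"
  shows "boundary_action (h \<circ> g) \<xi> = boundary_action h (boundary_action g \<xi>)"
proof
  fix n
  show "boundary_action (h \<circ> g) \<xi> n = boundary_action h (boundary_action g \<xi>) n"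
    unfolding boundary_action_def[of h] map_boundary_action[OF assms]
    by (simp add: boundary_action_def)
qed

abbreviation \<G> :: "(bool list \<Rightarrow> bool list) monoid" where "\<G> \<equiv> grigorchuk_group"

interpretation grig: group \<G> by (rule group_grigorchuk_group)

lemma mult_grig [simp]: "g \<otimes>\<^bsub>\<G>\<^esub> h = h \<circ> g" and one_grig [simp]: "\<one>\<^bsub>\<G>\<^esub> = id"
  by (simp_all add: grigorchuk_group_def tree_aut_group_def)

lemma carrier_grig_tree: "g \<in> carrier \<G> \<Longrightarrow> tree_automorphism g"
  using group.carrier_subgroup_generated_subset[OF group_tree_aut_group]
  unfolding grigorchuk_group_def by (auto simp: tree_aut_group_def)

lemma boundary_action_mult:
  "g \<in> carrier \<G> \<Longrightarrow> boundary_action (g \<otimes>\<^bsub>\<G>\<^esub> h) \<xi> = boundary_action h (boundary_action g \<xi>)"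
  by (simp add: boundary_action_comp carrier_grig_tree)

definition word_map :: "letter list \<Rightarrow> bool list \<Rightarrow> bool list" where
  "word_map w = foldr (\<lambda>s h. s \<otimes>\<^bsub>\<G>\<^esub> h) (map letter_map w) \<one>\<^bsub>\<G>\<^esub>"

lemma word_map_Nil [simp]: "word_map [] = id" and word_map_Cons [simp]: "word_map (s # w) = word_map w \<circ> letter_map s"
  by (simp_all add: word_map_def)

lemma letter_map_carrier [simp]: "letter_map s \<in> carrier \<G>"
  unfolding carrier_grigorchuk_group by (rule generate.incl) (cases s; simp add: gr_gens_def)

lemma letter_map_involution: "letter_map s \<circ> letter_map s = id"
  by (cases s) (simp_all add: fun_eq_iff gr_gens_involution)

lemma word_map_append: "word_map (v @ w) = word_map w \<circ> word_map v"
  by (induction v) (simp_all add: comp_assoc)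

lemma word_map_carrier [simp]: "word_map w \<in> carrier \<G>"
proof (induction w)
  case Nil
  show ?case using grig.one_closed by (simp only: one_grig word_map_Nil)
next
  case (Cons s w)
  then show ?case using grig.m_closed[OF letter_map_carrier[of s] Cons] by (simp only: mult_grig word_map_Cons)
qed

lemma word_map_rev: "word_map (rev w) \<circ> word_map w = id"
proof (induction w)
  case (Cons s w)
  have "word_map (rev (s # w)) \<circ> word_map (s # w) = letter_map s \<circ> (word_map (rev w) \<circ> word_map w) \<circ> letter_map s"
    by (simp add: word_map_append comp_assoc)
  also have "\<dots> = id" by (simp only: Cons letter_map_involution comp_id)
  finally show ?case .
qed simp

lemma inv_word_map: "inv\<^bsub>\<G>\<^esub> (word_map w) = word_map (rev w)"
proof -
  have "word_map (rev w) \<otimes>\<^bsub>\<G>\<^esub> word_map w = \<one>\<^bsub>\<G>\<^esub>" using word_map_rev[of "rev w"] by simp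
  then show ?thesis by (intro grig.inv_equality) simp_all
qed

lemma boundary_action_word_map: "boundary_action (word_map w) \<xi> = act w \<xi>"
proof (induction w arbitrary: \<xi>)
  case Nil
  show ?case by (simp only: word_map_Nil boundary_action_id act_Nil)
next
  case (Cons s w)
  have "boundary_action (word_map (s # w)) \<xi> = boundary_action (word_map w) (boundary_action (letter_map s) \<xi>)"
    using boundary_action_mult[OF letter_map_carrier, of s "word_map w"] by (simp only: mult_grig word_map_Cons)
  then show ?case using Cons by (simp only: letter_act_def act_Cons)
qed

lemma gr_gens_eq_range: "gr_gens = range letter_map"
proof -
  have univ: "UNIV = {A, B, C, D}" using letter.exhaust by auto
  show ?thesis unfolding univ by (simp add: gr_gens_def)
qed

lemma carrier_is_word_map: "g \<in> carrier \<G> \<Longrightarrow> \<exists>w. g = word_map w"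
  unfolding carrier_grigorchuk_group
proof (induction rule: generate.induct)
  case one
  then show ?case by (intro exI[of _ "[]"]) (simp add: tree_aut_group_def)
next
  case (incl h)
  then obtain s where "h = letter_map s" unfolding gr_gens_eq_range by blast
  then show ?case by (intro exI[of _ "[s]"]) simp
next
  case (inv h)
  then obtain s where s: "h = letter_map s" unfolding gr_gens_eq_range by blast
  interpret T: group tree_aut_group by (rule group_tree_aut_group)
  have "inv\<^bsub>tree_aut_group\<^esub> h = h"
  proof (rule T.inv_equality)
    show "h \<in> carrier tree_aut_group" "h \<in> carrier tree_aut_group"
      using inv gr_gens_subset by auto
    show "h \<otimes>\<^bsub>tree_aut_group\<^esub> h = \<one>\<^bsub>tree_aut_group\<^esub>"
      using letter_map_involution[of s] by (simp add: s tree_aut_group_def)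
  qed
  then show ?case by (intro exI[of _ "[s]"]) (simp add: s)
next
  case (eng g h)
  then obtain v w where "g = word_map v" "h = word_map w" by blast
  then show ?case by (intro exI[of _ "v @ w"]) (simp add: tree_aut_group_def word_map_append)
qed

text \<open>The generators are involutions, so adjoining their inverses does not change the alphabet.\<close>

lemma word_length_eq:
  "word_length \<G> gr_gens g = (LEAST n. \<exists>w. length w = n \<and> word_map w = g)"
proof -
  have "inv\<^bsub>\<G>\<^esub> (letter_map s) = letter_map s" for s using inv_word_map[of "[s]"] by simp
  then have gens: "gr_gens \<union> m_inv \<G> ` gr_gens = range letter_map"
    unfolding gr_gens_eq_range by auto
  have "(\<exists>ws. length ws = n \<and> set ws \<subseteq> range letter_map \<and>
      foldr (\<lambda>s h. s \<otimes>\<^bsub>\<G>\<^esub> h) ws \<one>\<^bsub>\<G>\<^esub> = g) \<longleftrightarrow> (\<exists>w. length w = n \<and> word_map w = g)" for n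
  proof
    assume "\<exists>ws. length ws = n \<and> set ws \<subseteq> range letter_map \<and> foldr (\<lambda>s h. s \<otimes>\<^bsub>\<G>\<^esub> h) ws \<one>\<^bsub>\<G>\<^esub> = g"
    then obtain ws where ws: "length ws = n" "ws \<in> lists (range letter_map)"
        "foldr (\<lambda>s h. s \<otimes>\<^bsub>\<G>\<^esub> h) ws \<one>\<^bsub>\<G>\<^esub> = g" by auto
    then obtain w where "ws = map letter_map w" by (auto simp: lists_image)
    then show "\<exists>w. length w = n \<and> word_map w = g" using ws by (auto simp: word_map_def)
  next
    assume "\<exists>w. length w = n \<and> word_map w = g"
    then obtain w where "length w = n" "word_map w = g" by blast
    then show "\<exists>ws. length ws = n \<and> set ws \<subseteq> range letter_map \<and> foldr (\<lambda>s h. s \<otimes>\<^bsub>\<G>\<^esub> h) ws \<one>\<^bsub>\<G>\<^esub> = g"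
      by (intro exI[of _ "map letter_map w"]) (auto simp: word_map_def)
  qed
  then show ?thesis unfolding word_length_def gens by (simp only:)
qed

lemma word_length_word_map_le: "word_length \<G> gr_gens (word_map w) \<le> length w"
  unfolding word_length_eq by (rule Least_le) blast

lemma geodesic_word:
  assumes "g \<in> carrier \<G>"
  obtains w where "word_map w = g" "length w = word_length \<G> gr_gens g"
proof -
  have "\<exists>n w. length w = n \<and> word_map w = g" using carrier_is_word_map[OF assms] by blast
  then have "\<exists>w. length w = word_length \<G> gr_gens g \<and> word_map w = g"
    unfolding word_length_eq by (rule LeastI_ex)
  then show thesis using that by blast
qed

section \<open>Cosets\<close>

abbreviation ones :: "nat \<Rightarrow> bool" where "ones \<equiv> \<lambda>_. True"

abbreviation \<H> :: "(bool list \<Rightarrow> bool list) set" where "\<H> \<equiv> ray_stabilizer \<G> ones"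

abbreviation \<V> :: "(bool list \<Rightarrow> bool list) set set" where "\<V> \<equiv> rcosets\<^bsub>\<G>\<^esub> \<H>"

lemma boundary_action_inv:
  assumes "g \<in> carrier \<G>"
  shows "boundary_action (inv\<^bsub>\<G>\<^esub> g) (boundary_action g \<xi>) = \<xi>"
    and "boundary_action g (boundary_action (inv\<^bsub>\<G>\<^esub> g) \<xi>) = \<xi>"
proof -
  obtain w where "g = word_map w" using carrier_is_word_map[OF assms] by blast
  then show "boundary_action (inv\<^bsub>\<G>\<^esub> g) (boundary_action g \<xi>) = \<xi>"
    and "boundary_action g (boundary_action (inv\<^bsub>\<G>\<^esub> g) \<xi>) = \<xi>"
    using act_rev_act[of "rev w"] by (simp_all add: inv_word_map boundary_action_word_map)
qed

text \<open>Orbit and stabilizer: a coset is determined by the ray to which its elements move \<open>1\<^sup>\<infinity>\<close>.\<close>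

lemma coset_eq_same_ray:
  assumes x: "x \<in> carrier \<G>"
  shows "\<H> #>\<^bsub>\<G>\<^esub> x = {g \<in> carrier \<G>. boundary_action g ones = boundary_action x ones}"
proof (rule Set.set_eqI, rule iffI)
  fix g assume "g \<in> \<H> #>\<^bsub>\<G>\<^esub> x"
  then obtain h where h: "h \<in> carrier \<G>" "boundary_action h ones = ones" "g = h \<otimes>\<^bsub>\<G>\<^esub> x"
    by (auto simp: r_coset_def ray_stabilizer_def)
  then show "g \<in> {g \<in> carrier \<G>. boundary_action g ones = boundary_action x ones}"
    using grig.m_closed[OF h(1) x] boundary_action_mult[OF h(1), of x ones] by simp
next
  fix g assume g: "g \<in> {g \<in> carrier \<G>. boundary_action g ones = boundary_action x ones}"
  define h where "h = g \<otimes>\<^bsub>\<G>\<^esub> inv\<^bsub>\<G>\<^esub> x"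
  have hc: "h \<in> carrier \<G>" unfolding h_def using g x by (intro grig.m_closed grig.inv_closed) simp_all
  have "boundary_action h ones = ones"
    unfolding h_def using g x boundary_action_inv(1)[OF x, of ones]
    by (subst boundary_action_mult) simp_all
  moreover have "g = h \<otimes>\<^bsub>\<G>\<^esub> x"
    unfolding h_def using g x grig.inv_solve_right' by (simp del: mult_grig one_grig add: grig.m_assoc)
  ultimately show "g \<in> \<H> #>\<^bsub>\<G>\<^esub> x"
    using hc unfolding r_coset_def ray_stabilizer_def by blast
qed

definition coset_ray :: "(bool list \<Rightarrow> bool list) set \<Rightarrow> nat \<Rightarrow> bool" where
  "coset_ray T = boundary_action (SOME g. g \<in> T) ones"

lemma coset_ray_coset:
  assumes "x \<in> carrier \<G>"
  shows "coset_ray (\<H> #>\<^bsub>\<G>\<^esub> x) = boundary_action x ones"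
proof -
  have "x \<in> \<H> #>\<^bsub>\<G>\<^esub> x" using assms by (simp add: coset_eq_same_ray)
  then have "(SOME g. g \<in> \<H> #>\<^bsub>\<G>\<^esub> x) \<in> \<H> #>\<^bsub>\<G>\<^esub> x"
    by (rule someI[where P = "\<lambda>g. g \<in> \<H> #>\<^bsub>\<G>\<^esub> x"])
  then show ?thesis using assms by (simp add: coset_ray_def coset_eq_same_ray)
qed

lemma coset_cases:
  assumes "T \<in> \<V>"
  obtains x where "x \<in> carrier \<G>" "T = \<H> #>\<^bsub>\<G>\<^esub> x"
  using assms by (auto simp: RCOSETS_def)

lemma H_subset: "\<H> \<subseteq> carrier \<G>"
  by (auto simp: ray_stabilizer_def)

lemma inj_on_coset_ray: "inj_on coset_ray \<V>"
proof (rule inj_onI)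
  fix T U assume "T \<in> \<V>" "U \<in> \<V>" and eq: "coset_ray T = coset_ray U"
  then obtain x y where xy: "x \<in> carrier \<G>" "T = \<H> #>\<^bsub>\<G>\<^esub> x" "y \<in> carrier \<G>" "U = \<H> #>\<^bsub>\<G>\<^esub> y"
    by (metis coset_cases)
  then have "boundary_action x ones = boundary_action y ones" using eq by (simp add: coset_ray_coset)
  then show "T = U" unfolding xy coset_eq_same_ray[OF xy(1)] coset_eq_same_ray[OF xy(3)] by simp
qed

lemma translate_coset:
  assumes T: "T \<in> \<V>" and g: "g \<in> carrier \<G>"
  shows "T #>\<^bsub>\<G>\<^esub> g \<in> \<V>" and "coset_ray (T #>\<^bsub>\<G>\<^esub> g) = boundary_action g (coset_ray T)"
    and "(T #>\<^bsub>\<G>\<^esub> g) #>\<^bsub>\<G>\<^esub> inv\<^bsub>\<G>\<^esub> g = T" and "(T #>\<^bsub>\<G>\<^esub> inv\<^bsub>\<G>\<^esub> g) #>\<^bsub>\<G>\<^esub> g = T"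
proof -
  obtain x where x: "x \<in> carrier \<G>" "T = \<H> #>\<^bsub>\<G>\<^esub> x" using T by (rule coset_cases)
  have xg: "x \<otimes>\<^bsub>\<G>\<^esub> g \<in> carrier \<G>" using x(1) g by (rule grig.m_closed)
  have eq: "T #>\<^bsub>\<G>\<^esub> g = \<H> #>\<^bsub>\<G>\<^esub> (x \<otimes>\<^bsub>\<G>\<^esub> g)"
    unfolding x(2) by (rule grig.coset_mult_assoc[OF H_subset x(1) g])
  show "T #>\<^bsub>\<G>\<^esub> g \<in> \<V>" unfolding eq by (rule grig.rcosetsI[OF H_subset xg])
  show "coset_ray (T #>\<^bsub>\<G>\<^esub> g) = boundary_action g (coset_ray T)"
    unfolding eq coset_ray_coset[OF xg] boundary_action_mult[OF x(1)] by (simp add: x coset_ray_coset)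
  have Ac: "T \<subseteq> carrier \<G>" unfolding x(2) by (rule grig.r_coset_subset_G[OF H_subset x(1)])
  show "(T #>\<^bsub>\<G>\<^esub> g) #>\<^bsub>\<G>\<^esub> inv\<^bsub>\<G>\<^esub> g = T" "(T #>\<^bsub>\<G>\<^esub> inv\<^bsub>\<G>\<^esub> g) #>\<^bsub>\<G>\<^esub> g = T"
    using Ac g by (simp_all add: grig.coset_mult_assoc grig.coset_mult_one[OF Ac, simplified]
        grig.r_inv grig.l_inv del: mult_grig)
qed

lemma coset_ray_in_ones_from: "T \<in> \<V> \<Longrightarrow> \<exists>n. coset_ray T \<in> ones_from n"
proof (elim coset_cases)
  fix x assume x: "x \<in> carrier \<G>" "T = \<H> #>\<^bsub>\<G>\<^esub> x"
  obtain w where "x = word_map w" using carrier_is_word_map[OF x(1)] by blast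
  then have "coset_ray T = act w ones" using x by (simp add: coset_ray_coset boundary_action_word_map)
  then show ?thesis using act_ones_from[of ones 0 w] by (auto simp: ones_from_0)
qed

lemma finite_coset_ray_ones_from: "finite {T \<in> \<V>. coset_ray T \<in> ones_from n}"
  by (rule finite_imageD[of coset_ray])
    (auto intro: finite_subset[OF _ finite_ones_from[of n]] inj_on_subset[OF inj_on_coset_ray])

lemma base_coset: "\<H> \<in> \<V>" "coset_ray \<H> = ones"
proof -
  have id: "id \<in> carrier \<G>" using grig.one_closed by (simp only: one_grig)
  have H: "\<H> #>\<^bsub>\<G>\<^esub> id = \<H>" using grig.coset_mult_one[OF H_subset] by (simp only: one_grig)
  show "\<H> \<in> \<V>" using grig.rcosetsI[OF H_subset id] by (simp only: H)
  show "coset_ray \<H> = ones" using coset_ray_coset[OF id] by (simp only: H boundary_action_id)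
qed

section \<open>The induced walk\<close>

lemma pmf_of_bool_summable:
  "(\<lambda>g. pmf \<mu> g * of_bool (Q g)) summable_on W"
  by (rule summable_on_mult_bounded[where C = 1])
    (auto intro: has_sum_imp_summable[OF pmf_has_sum[OF subset_UNIV], THEN summable_on_subset_banach])

lemma coset_kernel_ge:
  assumes "g \<in> carrier \<G>"
  shows "pmf \<mu> g \<le> coset_kernel \<G> \<mu> T (T #>\<^bsub>\<G>\<^esub> g)"
proof -
  have "(\<Sum>h\<in>{g}. pmf \<mu> h * of_bool (T #>\<^bsub>\<G>\<^esub> h = T #>\<^bsub>\<G>\<^esub> g)) \<le> coset_kernel \<G> \<mu> T (T #>\<^bsub>\<G>\<^esub> g)"
    unfolding coset_kernel_def using assms
    by (intro finite_sum_le_infsum pmf_of_bool_summable) auto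
  then show ?thesis by simp
qed

text \<open>Symmetry comes from the substitution of \<open>g\<close> by its inverse. A row sums to 1 because each \<open>g\<close> leads from a given coset
to exactly one coset.\<close>

lemma symmetric_kernel_coset:
  assumes \<mu>: "symmetric_prob \<G> \<mu>"
  shows "symmetric_kernel \<V> (coset_kernel \<G> \<mu>)"
proof
  fix T U assume T: "T \<in> \<V>" and U: "U \<in> \<V>"
  show "0 \<le> coset_kernel \<G> \<mu> T U" unfolding coset_kernel_def by (rule infsum_nonneg) simp
  show "coset_kernel \<G> \<mu> T U = coset_kernel \<G> \<mu> U T"
    unfolding coset_kernel_def
  proof (rule infsum_reindex_bij_witness[of _ "m_inv \<G>" "m_inv \<G>"])
    fix g assume g: "g \<in> carrier \<G>"
    have "U #>\<^bsub>\<G>\<^esub> inv\<^bsub>\<G>\<^esub> g = T \<longleftrightarrow> T #>\<^bsub>\<G>\<^esub> g = U"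
      using translate_coset(3)[OF T g] translate_coset(4)[OF U g] by auto
    then show "pmf \<mu> (inv\<^bsub>\<G>\<^esub> g) * of_bool (U #>\<^bsub>\<G>\<^esub> inv\<^bsub>\<G>\<^esub> g = T) = pmf \<mu> g * of_bool (T #>\<^bsub>\<G>\<^esub> g = U)"
      using \<mu> g by (simp add: symmetric_prob_def)
  qed simp_all
next
  fix T assume T: "T \<in> \<V>"
  let ?f = "\<lambda>(U, g). pmf \<mu> g * of_bool (T #>\<^bsub>\<G>\<^esub> g = U)"
  have sub: "set_pmf \<mu> \<subseteq> carrier \<G>" using \<mu> by (simp add: symmetric_prob_def)
  have "(?f \<circ> (\<lambda>g. (T #>\<^bsub>\<G>\<^esub> g, g)) has_sum 1) (carrier \<G>)"
    using pmf_has_sum[OF sub] by (simp add: comp_def)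
  then have "(?f has_sum 1) ((\<lambda>g. (T #>\<^bsub>\<G>\<^esub> g, g)) ` carrier \<G>)"
    by (subst has_sum_reindex) (auto intro: inj_onI)
  then have "(?f has_sum 1) (\<V> \<times> carrier \<G>)"
    by (rule has_sum_cong_neutral[THEN iffD1, rotated -1]) (auto simp: translate_coset(1)[OF T])
  then show "(coset_kernel \<G> \<mu> T has_sum 1) \<V>"
  proof (rule has_sum_SigmaD)
    fix U
    show "((\<lambda>g. ?f (U, g)) has_sum coset_kernel \<G> \<mu> T U) (carrier \<G>)"
      unfolding coset_kernel_def prod.case by (rule has_sum_infsum) (rule pmf_of_bool_summable)
  qed
qed

section \<open>A transient walk below the critical exponent\<close>

text \<open>A geometrically distributed \<open>n\<close>, and then the \<open>n\<close>-th flipping element or its inverse with probability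
\<open>1/2\<close> each, which makes the distribution symmetric.\<close>

definition flip_walk :: "real \<Rightarrow> (bool list \<Rightarrow> bool list) pmf" where
  "flip_walk r = map_pmf (\<lambda>(n, b). word_map (if b then flip_word n else rev (flip_word n)))
     (pair_pmf (geometric_pmf (1 - r)) (bernoulli_pmf (1 / 2)))"

lemma symmetric_flip_walk: "symmetric_prob \<G> (flip_walk r)"
  unfolding symmetric_prob_def
proof (intro conjI ballI)
  show "set_pmf (flip_walk r) \<subseteq> carrier \<G>" by (auto simp: flip_walk_def)
  fix g assume g: "g \<in> carrier \<G>"
  let ?p = "pair_pmf (geometric_pmf (1 - r)) (bernoulli_pmf (1 / 2))"
  let ?\<phi> = "\<lambda>(n, b). word_map (if b then flip_word n else rev (flip_word n))"
  let ?\<sigma> = "\<lambda>(n, b). (n, \<not> b)"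
  \<comment> \<open>Inversion corresponds to negating the fair coin, which does not change its distribution.\<close>
  have "map_pmf Not (bernoulli_pmf (1 / 2)) = bernoulli_pmf (1 / 2)"
  proof (rule pmf_eqI)
    fix b
    show "pmf (map_pmf Not (bernoulli_pmf (1 / 2))) b = pmf (bernoulli_pmf (1 / 2)) b"
      using pmf_map_inj'[of Not "bernoulli_pmf (1 / 2)" "\<not> b"] by (cases b) (simp_all add: inj_def)
  qed
  then have "map_pmf ?\<sigma> ?p = ?p"
    using map_pair[of id Not "geometric_pmf (1 - r)" "bernoulli_pmf (1 / 2)"]
    by (simp add: map_prod_def)
  moreover have "?\<phi> z = inv\<^bsub>\<G>\<^esub> g \<longleftrightarrow> ?\<phi> (?\<sigma> z) = g" for z
  proof -
    have inv: "inv\<^bsub>\<G>\<^esub> (?\<phi> z) = ?\<phi> (?\<sigma> z)" by (cases z) (simp add: inv_word_map)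
    have z: "?\<phi> z \<in> carrier \<G>" by (cases z) simp
    have "?\<phi> z = inv\<^bsub>\<G>\<^esub> g \<longleftrightarrow> inv\<^bsub>\<G>\<^esub> (?\<phi> z) = g"
      using grig.inv_inv[OF z] grig.inv_inv[OF g] by (intro iffI) simp_all
    then show ?thesis by (simp only: inv)
  qed
  then have "?\<phi> -` {inv\<^bsub>\<G>\<^esub> g} = ?\<sigma> -` (?\<phi> -` {g})" by blast
  then have "measure ?p (?\<phi> -` {inv\<^bsub>\<G>\<^esub> g}) = measure (map_pmf ?\<sigma> ?p) (?\<phi> -` {g})"
    by (simp only: measure_map_pmf)
  ultimately show "pmf (flip_walk r) (inv\<^bsub>\<G>\<^esub> g) = pmf (flip_walk r) g"
    unfolding flip_walk_def pmf_map by (simp only:)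
qed

lemma pmf_flip_walk_ge:
  assumes "0 < r" "r < 1"
  shows "(1 - r) / 2 * r ^ n \<le> pmf (flip_walk r) (word_map (flip_word n))"
proof -
  let ?p = "pair_pmf (geometric_pmf (1 - r)) (bernoulli_pmf (1 / 2))"
  let ?\<phi> = "\<lambda>(n, b). word_map (if b then flip_word n else rev (flip_word n))"
  have "measure ?p {(n, True)} \<le> measure ?p (?\<phi> -` {word_map (flip_word n)})"
    by (rule measure_pmf.finite_measure_mono) auto
  then have "pmf ?p (n, True) \<le> pmf (flip_walk r) (word_map (flip_word n))"
    by (simp only: flip_walk_def pmf_map measure_pmf_single)
  then show ?thesis using assms by (simp add: pmf_pair mult.commute)
qed

text \<open>The moment is dominated by the geometric series of \<open>r \<lambda>\<^sub>0\<^sup>\<beta>\<close>.\<close>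

lemma finite_moment_flip_walk:
  assumes r: "0 < r" "r < 1" and \<beta>: "0 \<le> \<beta>" and r\<beta>: "r * lambda0 powr \<beta> < 1"
  shows "finite_moment \<G> gr_gens \<beta> (flip_walk r)"
  unfolding finite_moment_def
proof (rule integrable_imp_summable_on_pmf)
  let ?p = "pair_pmf (geometric_pmf (1 - r)) (bernoulli_pmf (1 / 2))"
  let ?\<phi> = "\<lambda>(n, b). word_map (if b then flip_word n else rev (flip_word n))"
  let ?h = "\<lambda>n. (2 * lambda0 ^ n) powr \<beta>"
  have h: "?h n = 2 powr \<beta> * (lambda0 powr \<beta>) ^ n" for n
    using lambda0_pos by (simp add: powr_mult powr_realpow[symmetric] powr_powr powr_power mult.commute)
  have "summable (\<lambda>n. (1 - r) * 2 powr \<beta> * (r * lambda0 powr \<beta>) ^ n)"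
    using r r\<beta> by (intro summable_mult summable_geometric) simp
  then have "integrable (count_space UNIV) (\<lambda>n. (r ^ n * (1 - r)) *\<^sub>R ?h n)"
    unfolding integrable_count_space_nat_iff using r
    by (simp add: h power_mult_distrib abs_mult mult_ac)
  then have "integrable (geometric_pmf (1 - r)) ?h"
    unfolding measure_pmf_eq_density using r by (subst integrable_density) auto
  then have "integrable (map_pmf fst ?p) ?h" by (simp only: map_fst_pair_pmf)
  then have int: "integrable ?p (\<lambda>z. ?h (fst z))" by (simp only: integrable_map_pmf_eq)
  have "integrable ?p (\<lambda>z. real (word_length \<G> gr_gens (?\<phi> z)) powr \<beta>)"
  proof (rule Bochner_Integration.integrable_bound[OF int])
    have "real (word_length \<G> gr_gens (?\<phi> z)) \<le> 2 * lambda0 ^ fst z" for z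
    proof -
      obtain n b where z: "z = (n, b)" by (cases z)
      have "word_length \<G> gr_gens (?\<phi> z) \<le> length (flip_word n)"
        using word_length_word_map_le[of "flip_word n"] word_length_word_map_le[of "rev (flip_word n)"]
        by (simp add: z)
      then show ?thesis using length_flip_word[of n] by (simp add: z)
    qed
    then show "AE z in ?p. norm (real (word_length \<G> gr_gens (?\<phi> z)) powr \<beta>) \<le> norm (?h (fst z))"
      using \<beta> by (intro AE_I2) (simp add: powr_mono2)
  qed simp
  then show "integrable (flip_walk r) (\<lambda>g. real (word_length \<G> gr_gens g) powr \<beta>)"
    unfolding flip_walk_def integrable_map_pmf_eq .
qed

text \<open>From a coset whose ray lies in \<open>I\<^sub>m\<close> the doubling starts at level \<open>m\<close>: the flip of the letter \<open>m + n\<close> moves the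
points reached so far, which lie in \<open>I\<^bsub>m+n\<^esub>\<close>, out of this set but keeps them in \<open>I\<^bsub>m+n+1\<^esub>\<close>.\<close>

lemma transient_flip_walk:
  assumes r: "1 / 2 < r" "r < 1"
  shows "transient_chain \<V> (coset_kernel \<G> (flip_walk r))"
  unfolding transient_chain_def
proof
  interpret symmetric_kernel \<V> "coset_kernel \<G> (flip_walk r)"
    by (rule symmetric_kernel_coset[OF symmetric_flip_walk])
  fix T assume T: "T \<in> \<V>"
  obtain m where m: "coset_ray T \<in> ones_from m" using coset_ray_in_ones_from[OF T] by blast
  define \<phi> where "\<phi> n U = U #>\<^bsub>\<G>\<^esub> word_map (flip_word (m + n))" for n U
  define J where "J = rec_nat {T} (\<lambda>n S. S \<union> \<phi> n ` S)"
  have J: "J 0 = {T}" "\<And>n. J (Suc n) = J n \<union> \<phi> n ` J n" by (simp_all add: J_def)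
  have flip: "\<phi> n U \<in> \<V>" "coset_ray (\<phi> n U) \<in> ones_from (m + Suc n)" "coset_ray (\<phi> n U) \<notin> ones_from (m + n)"
    if U: "U \<in> \<V>" "coset_ray U \<in> ones_from (m + n)" for n U
  proof -
    show "\<phi> n U \<in> \<V>" unfolding \<phi>_def by (rule translate_coset(1)[OF U(1) word_map_carrier])
    have "coset_ray U \<in> ones_from (Suc (m + n))" using U(2) ones_from_mono[of "m + n" "Suc (m + n)"] by auto
    then have "coset_ray (\<phi> n U) = (coset_ray U)(m + n := \<not> coset_ray U (m + n))"
      unfolding \<phi>_def translate_coset(2)[OF U(1) word_map_carrier] boundary_action_word_map by (rule act_flip_word)
    then show "coset_ray (\<phi> n U) \<in> ones_from (m + Suc n)" "coset_ray (\<phi> n U) \<notin> ones_from (m + n)"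
      using U(2) by (auto simp: ones_from_def)
  qed
  have inv: "J n \<subseteq> {U \<in> \<V>. coset_ray U \<in> ones_from (m + n)}" for n
  proof (induction n)
    case 0
    show ?case using T m by (simp add: J)
  next
    case (Suc n)
    have "J n \<subseteq> {U \<in> \<V>. coset_ray U \<in> ones_from (m + Suc n)}"
      using Suc ones_from_mono[of "m + n" "m + Suc n"] by auto
    moreover have "\<phi> n ` J n \<subseteq> {U \<in> \<V>. coset_ray U \<in> ones_from (m + Suc n)}"
      using Suc flip by blast
    ultimately show ?case unfolding J by blast
  qed
  show "summable (\<lambda>n. kernel_power \<V> (coset_kernel \<G> (flip_walk r)) n T T)"
  proof (rule transient_if_doubling[OF J, where \<kappa> = "(1 - r) / 2 * r ^ m" and r = r])
    show "J n \<subseteq> \<V>" for n using inv by blast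
    show "inj_on (\<phi> n) (J n)" for n
      using translate_coset(3)[OF _ word_map_carrier[of "flip_word (m + n)"]] inv[of n] unfolding \<phi>_def
      by (intro inj_on_inverseI[where g = "\<lambda>U. U #>\<^bsub>\<G>\<^esub> inv\<^bsub>\<G>\<^esub> word_map (flip_word (m + n))"]) blast
    show "J n \<inter> \<phi> n ` J n = {}" for n using inv[of n] flip(3) by blast
    fix n U
    have "(1 - r) / 2 * r ^ (m + n) \<le> pmf (flip_walk r) (word_map (flip_word (m + n)))"
      using r by (intro pmf_flip_walk_ge) auto
    also have "\<dots> \<le> coset_kernel \<G> (flip_walk r) U (\<phi> n U)"
      unfolding \<phi>_def by (rule coset_kernel_ge[OF word_map_carrier])
    finally show "(1 - r) / 2 * r ^ m * r ^ n \<le> coset_kernel \<G> (flip_walk r) U (\<phi> n U)"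
      by (simp add: power_add)
  qed (use r in simp_all)
qed

section \<open>Recurrence at the critical exponent\<close>

text \<open>The average of the indicators of \<open>I\<^sub>0, \<dots>, I\<^bsub>N-1\<^esub>\<close>. A single indicator is no good test function: a
fixed element may cross the boundaries of infinitely many \<open>I\<^sub>n\<close>, so the Dirichlet forms of the indicators
need not tend to 0.\<close>

definition ramp :: "nat \<Rightarrow> (nat \<Rightarrow> bool) \<Rightarrow> real" where
  "ramp N \<xi> = (\<Sum>k<N. of_bool (\<xi> \<in> ones_from k)) / N"

lemma ramp_bounds: "0 \<le> ramp N \<xi>" "ramp N \<xi> \<le> 1"
proof -
  show "0 \<le> ramp N \<xi>" unfolding ramp_def by (intro divide_nonneg_nonneg sum_nonneg) simp_all
  have "(\<Sum>k<N. of_bool (\<xi> \<in> ones_from k) :: real) \<le> (\<Sum>k<N. 1)" by (intro sum_mono) simp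
  then show "ramp N \<xi> \<le> 1" unfolding ramp_def by (cases "N = 0") (simp_all add: divide_le_eq)
qed

text \<open>A word of length \<open>l\<close> maps \<open>I\<^sub>k\<close> into \<open>I\<^bsub>k+l\<^esub>\<close>, so it changes at most \<open>l\<close> of the \<open>N\<close> indicators in one direction.\<close>

lemma ramp_le_act: "ramp N \<xi> \<le> ramp N (act w \<xi>) + length w / N"
proof -
  let ?l = "length w"
  have "(\<Sum>k<N. of_bool (\<xi> \<in> ones_from k) :: real) \<le> (\<Sum>k<N. of_bool (act w \<xi> \<in> ones_from (k + ?l)))"
    by (intro sum_mono) (auto dest: act_ones_from[of _ _ w])
  also have "\<dots> = (\<Sum>k\<in>(\<lambda>k. k + ?l) ` {..<N}. of_bool (act w \<xi> \<in> ones_from k))"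
    by (subst sum.reindex) auto
  also have "\<dots> \<le> (\<Sum>k\<in>{..<N} \<union> {N..<N + ?l}. of_bool (act w \<xi> \<in> ones_from k))"
    by (rule sum_mono2) auto
  also have "\<dots> = (\<Sum>k<N. of_bool (act w \<xi> \<in> ones_from k)) + (\<Sum>k\<in>{N..<N + ?l}. of_bool (act w \<xi> \<in> ones_from k))"
    by (rule sum.union_disjoint) auto
  also have "(\<Sum>k\<in>{N..<N + ?l}. of_bool (act w \<xi> \<in> ones_from k) :: real) \<le> (\<Sum>k\<in>{N..<N + ?l}. 1)"
    by (intro sum_mono) simp
  finally have "(\<Sum>k<N. of_bool (\<xi> \<in> ones_from k) :: real) \<le>
      (\<Sum>k<N. of_bool (act w \<xi> \<in> ones_from k) :: real) + real ?l"
    by simp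
  then show ?thesis unfolding ramp_def add_divide_distrib[symmetric] by (rule divide_right_mono) simp
qed

lemma ramp_lipschitz: "\<bar>ramp N \<xi> - ramp N (act w \<xi>)\<bar> \<le> length w / N"
  using ramp_le_act[of N \<xi> w] ramp_le_act[of N "act w \<xi>" "rev w"] by simp

lemma sum_indicator_diff_le_crossings:
  assumes "finite Z"
  shows "(\<Sum>\<xi>\<in>Z. \<bar>of_bool (\<xi> \<in> ones_from k) - of_bool (act w \<xi> \<in> ones_from k)\<bar> :: real)
    \<le> crossings k w + crossings k (rev w)"
proof -
  let ?P = "{\<xi> \<in> Z. \<xi> \<in> ones_from k \<and> act w \<xi> \<notin> ones_from k}" and ?Q = "{\<xi> \<in> Z. \<xi> \<notin> ones_from k \<and> act w \<xi> \<in> ones_from k}"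
  have "(\<Sum>\<xi>\<in>Z. \<bar>of_bool (\<xi> \<in> ones_from k) - of_bool (act w \<xi> \<in> ones_from k)\<bar> :: real) =
      (\<Sum>\<xi>\<in>Z. of_bool (\<xi> \<in> ?P) + of_bool (\<xi> \<in> ?Q))"
    by (intro sum.cong) auto
  also have "\<dots> = real (card ?P) + real (card ?Q)"
    using assms by (simp add: sum.distrib Int_def conj_ac)
  also have "card ?P \<le> crossings k w"
    unfolding crossings_def by (rule card_mono) (auto intro: finite_subset[OF _ finite_ones_from[of k]])
  also have "card ?Q \<le> crossings k (rev w)"
    unfolding crossings_def
    by (rule card_inj_on_le[of "act w"]) (auto intro: finite_subset[OF _ finite_ones_from[of k]] inj_on_subset[OF inj_act])
  finally show ?thesis by simp
qed

text \<open>The squares are at most the absolute differences times their maximum; the maximum is bounded through the Lipschitz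
estimate, and the sum of the differences through the crossings of \<open>w\<close> and of its inverse.\<close>

lemma sum_ramp_diff_le:
  assumes Z: "finite Z" and K: "\<And>n w. real (crossings n w) \<le> K * real (length w) powr alpha0" and K0: "0 \<le> K"
  shows "(\<Sum>\<xi>\<in>Z. (ramp N \<xi> - ramp N (act w \<xi>))\<^sup>2)
    \<le> min 1 (length w / N) * (2 * K * real (length w) powr alpha0)"
proof -
  let ?d = "\<lambda>k \<xi>. of_bool (\<xi> \<in> ones_from k) - of_bool (act w \<xi> \<in> ones_from k) :: real"
  have diff: "\<bar>ramp N \<xi> - ramp N (act w \<xi>)\<bar> \<le> (\<Sum>k<N. \<bar>?d k \<xi>\<bar>) / N" for \<xi>
    unfolding ramp_def diff_divide_distrib[symmetric] sum_subtractf[symmetric] abs_divide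
    by (simp add: divide_right_mono)
  have min: "\<bar>ramp N \<xi> - ramp N (act w \<xi>)\<bar> \<le> min 1 (length w / N)" for \<xi>
    using ramp_lipschitz[of N \<xi> w] ramp_bounds[of N \<xi>] ramp_bounds[of N "act w \<xi>"] by simp
  have "(\<Sum>\<xi>\<in>Z. \<bar>ramp N \<xi> - ramp N (act w \<xi>)\<bar>) \<le> (\<Sum>\<xi>\<in>Z. (\<Sum>k<N. \<bar>?d k \<xi>\<bar>) / N)"
    by (intro sum_mono diff)
  also have "\<dots> = (\<Sum>k<N. \<Sum>\<xi>\<in>Z. \<bar>?d k \<xi>\<bar>) / N"
    by (subst sum.swap) (simp add: sum_divide_distrib)
  also have "\<dots> \<le> (\<Sum>k<N. 2 * K * real (length w) powr alpha0) / N"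
  proof (intro divide_right_mono sum_mono)
    fix k
    show "(\<Sum>\<xi>\<in>Z. \<bar>?d k \<xi>\<bar>) \<le> 2 * K * real (length w) powr alpha0"
      using sum_indicator_diff_le_crossings[OF Z, of k w] K[of k w] K[of k "rev w"] by simp
  qed simp
  also have "\<dots> \<le> 2 * K * real (length w) powr alpha0" using K0 by simp
  finally have l1: "(\<Sum>\<xi>\<in>Z. \<bar>ramp N \<xi> - ramp N (act w \<xi>)\<bar>) \<le> 2 * K * real (length w) powr alpha0" .
  have "(\<Sum>\<xi>\<in>Z. (ramp N \<xi> - ramp N (act w \<xi>))\<^sup>2) \<le>
      (\<Sum>\<xi>\<in>Z. min 1 (length w / N) * \<bar>ramp N \<xi> - ramp N (act w \<xi>)\<bar>)"
  proof (rule sum_mono)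
    fix \<xi>
    have "(ramp N \<xi> - ramp N (act w \<xi>))\<^sup>2 = \<bar>ramp N \<xi> - ramp N (act w \<xi>)\<bar> * \<bar>ramp N \<xi> - ramp N (act w \<xi>)\<bar>"
      by (simp add: power2_eq_square)
    also have "\<dots> \<le> min 1 (length w / N) * \<bar>ramp N \<xi> - ramp N (act w \<xi>)\<bar>"
      by (rule mult_right_mono[OF min]) simp
    finally show "(ramp N \<xi> - ramp N (act w \<xi>))\<^sup>2 \<le> min 1 (length w / N) * \<bar>ramp N \<xi> - ramp N (act w \<xi>)\<bar>" .
  qed
  also have "\<dots> \<le> min 1 (length w / N) * (2 * K * real (length w) powr alpha0)"
    unfolding sum_distrib_left[symmetric] by (rule mult_left_mono[OF l1]) simp
  finally show ?thesis .
qed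

text \<open>The Dirichlet form is the \<open>\<mu>\<close>-average of the energies \<open>\<Sum>\<^sub>T (f T - f (T g))\<^sup>2\<close> of the single group elements.
Working with finite partial sums avoids a triple infinite sum.\<close>

lemma dirichlet_coset_kernel_le:
  assumes \<mu>: "symmetric_prob \<G> \<mu>"
    and f: "f summable_on \<V>"
    and b: "\<And>g Z. g \<in> carrier \<G> \<Longrightarrow> finite Z \<Longrightarrow> Z \<subseteq> \<V> \<Longrightarrow>
        (\<Sum>T\<in>Z. (f T - f (T #>\<^bsub>\<G>\<^esub> g))\<^sup>2) \<le> b g"
    and sm: "(\<lambda>g. pmf \<mu> g * b g) summable_on carrier \<G>"
  shows "symmetric_kernel.dirichlet \<V> (coset_kernel \<G> \<mu>) f \<le> (\<Sum>\<^sub>\<infinity>g\<in>carrier \<G>. pmf \<mu> g * b g)"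
proof -
  interpret symmetric_kernel \<V> "coset_kernel \<G> \<mu>" by (rule symmetric_kernel_coset[OF \<mu>])
  show ?thesis
    unfolding dirichlet_def
  proof (rule infsum_le_finite_sums)
    show "(\<lambda>(x, y). coset_kernel \<G> \<mu> x y * (f x - f y)\<^sup>2) summable_on \<V> \<times> \<V>"
      using dirichlet_form[OF f] by (rule has_sum_imp_summable)
    fix Z assume Z: "finite Z" "Z \<subseteq> \<V> \<times> \<V>"
    define e :: "_ \<Rightarrow> _ \<Rightarrow> real" where "e g z = of_bool (fst z #>\<^bsub>\<G>\<^esub> g = snd z) * (f (fst z) - f (snd z))\<^sup>2" for g z
    have sm1: "(\<lambda>g. pmf \<mu> g * e g z) summable_on carrier \<G>" for z
      using summable_on_cmult_left[OF pmf_of_bool_summable[of \<mu> "\<lambda>g. fst z #>\<^bsub>\<G>\<^esub> g = snd z"],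
          of "(f (fst z) - f (snd z))\<^sup>2"]
      by (simp add: e_def mult.assoc)
    have "coset_kernel \<G> \<mu> (fst z) (snd z) * (f (fst z) - f (snd z))\<^sup>2 =
        (\<Sum>\<^sub>\<infinity>g\<in>carrier \<G>. pmf \<mu> g * e g z)" for z
      unfolding coset_kernel_def e_def mult.assoc[symmetric] by (rule infsum_cmult_left'[symmetric])
    then have "(\<Sum>(x, y)\<in>Z. coset_kernel \<G> \<mu> x y * (f x - f y)\<^sup>2) =
        (\<Sum>z\<in>Z. \<Sum>\<^sub>\<infinity>g\<in>carrier \<G>. pmf \<mu> g * e g z)"
      by (simp only: case_prod_unfold)
    also have "\<dots> = (\<Sum>\<^sub>\<infinity>g\<in>carrier \<G>. \<Sum>z\<in>Z. pmf \<mu> g * e g z)"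
      by (rule infsumI[symmetric], rule has_sum_finite_sum) (use sm1 Z in auto)
    also have "\<dots> \<le> (\<Sum>\<^sub>\<infinity>g\<in>carrier \<G>. pmf \<mu> g * b g)"
    proof (rule infsum_mono)
      show "(\<lambda>g. \<Sum>z\<in>Z. pmf \<mu> g * e g z) summable_on carrier \<G>"
        by (rule has_sum_imp_summable, rule has_sum_finite_sum[OF Z(1)], rule has_sum_infsum, rule sm1)
      show "(\<lambda>g. pmf \<mu> g * b g) summable_on carrier \<G>" by (rule sm)
      fix g assume g: "g \<in> carrier \<G>"
      have "(\<Sum>z\<in>Z. e g z) \<le> (\<Sum>z\<in>fst ` Z \<times> snd ` Z. e g z)"
        using Z by (intro sum_mono2) (auto simp: e_def intro: rev_image_eqI)
      also have "\<dots> = (\<Sum>T\<in>fst ` Z. \<Sum>U\<in>snd ` Z. of_bool (T #>\<^bsub>\<G>\<^esub> g = U) * (f T - f U)\<^sup>2)"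
        by (simp add: sum.cartesian_product e_def case_prod_unfold)
      also have "\<dots> \<le> (\<Sum>T\<in>fst ` Z. (f T - f (T #>\<^bsub>\<G>\<^esub> g))\<^sup>2)"
      proof (rule sum_mono)
        fix T
        have "(\<Sum>U\<in>snd ` Z. of_bool (T #>\<^bsub>\<G>\<^esub> g = U) * (f T - f U)\<^sup>2) =
            (\<Sum>U\<in>snd ` Z. if T #>\<^bsub>\<G>\<^esub> g = U then (f T - f U)\<^sup>2 else 0)"
          by (intro sum.cong) auto
        also have "\<dots> \<le> (f T - f (T #>\<^bsub>\<G>\<^esub> g))\<^sup>2"
          using Z by (simp add: sum.delta')
        finally show "(\<Sum>U\<in>snd ` Z. of_bool (T #>\<^bsub>\<G>\<^esub> g = U) * (f T - f U)\<^sup>2) \<le> (f T - f (T #>\<^bsub>\<G>\<^esub> g))\<^sup>2" .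
      qed
      also have "\<dots> \<le> b g" using Z by (intro b g) auto
      finally show "(\<Sum>z\<in>Z. pmf \<mu> g * e g z) \<le> pmf \<mu> g * b g"
        unfolding sum_distrib_left[symmetric] by (rule mult_left_mono) simp
    qed
    finally show "(\<Sum>(x, y)\<in>Z. coset_kernel \<G> \<mu> x y * (f x - f y)\<^sup>2) \<le> (\<Sum>\<^sub>\<infinity>g\<in>carrier \<G>. pmf \<mu> g * b g)" .
  qed
qed

lemma recurrent_if_alpha0_moment:
  assumes \<mu>: "symmetric_prob \<G> \<mu>" and mom: "finite_moment \<G> gr_gens alpha0 \<mu>"
  shows "\<not> transient_chain \<V> (coset_kernel \<G> \<mu>)"
proof
  assume tr: "transient_chain \<V> (coset_kernel \<G> \<mu>)"
  interpret symmetric_kernel \<V> "coset_kernel \<G> \<mu>" by (rule symmetric_kernel_coset[OF \<mu>])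
  have base: "summable (\<lambda>n. kernel_power \<V> (coset_kernel \<G> \<mu>) n \<H> \<H>)"
    using tr base_coset unfolding transient_chain_def by blast
  obtain c where c: "c > 0" "\<And>f. finite {x. f x \<noteq> 0} \<Longrightarrow> f \<H> = 1 \<Longrightarrow> c \<le> dirichlet f"
    using dirichlet_lower_bound_if_summable[OF base_coset(1) base] by blast
  obtain K where K: "K > 0" "\<And>n w. real (crossings n w) \<le> K * real (length w) powr alpha0"
    using crossings_le_length_powr by blast
  let ?l = "\<lambda>g. real (word_length \<G> gr_gens g)"
  have sm: "(\<lambda>g. 2 * K * (?l g powr alpha0 * pmf \<mu> g)) summable_on carrier \<G>"
    using mom unfolding finite_moment_def by (intro summable_on_cmult_right)
  obtain N where N: "N > 0" "(\<Sum>\<^sub>\<infinity>g\<in>carrier \<G>. 2 * K * (?l g powr alpha0 * pmf \<mu> g) * min 1 (?l g / real N)) < c"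
  proof -
    have "\<exists>N>0. (\<Sum>\<^sub>\<infinity>g\<in>carrier \<G>. 2 * K * (?l g powr alpha0 * pmf \<mu> g) * min 1 (?l g / real N)) < c"
      by (rule infsum_min_arbitrarily_small[OF sm _ _ c(1)]) (use K(1) in simp_all)
    then show thesis using that by blast
  qed
  define f where "f T = (if T \<in> \<V> then ramp N (coset_ray T) else 0)" for T
  have fin: "finite {T. f T \<noteq> 0}"
  proof (rule finite_subset)
    show "{T. f T \<noteq> 0} \<subseteq> {T \<in> \<V>. coset_ray T \<in> ones_from N}"
    proof clarify
      fix T assume T: "f T \<noteq> 0"
      then have "T \<in> \<V>" by (auto simp: f_def split: if_splits)
      moreover have "\<exists>k<N. coset_ray T \<in> ones_from k"
      proof (rule ccontr)
        assume "\<not> (\<exists>k<N. coset_ray T \<in> ones_from k)"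
        then have "ramp N (coset_ray T) = 0" by (simp add: ramp_def)
        then show False using T by (auto simp: f_def split: if_splits)
      qed
      then have "coset_ray T \<in> ones_from N" using ones_from_mono by (meson less_imp_le subsetD)
      ultimately show "T \<in> \<V> \<and> coset_ray T \<in> ones_from N" by simp
    qed
  qed (rule finite_coset_ray_ones_from)
  have "f \<H> = 1" using base_coset N(1) by (simp add: f_def ramp_def ones_from_def)
  then have "c \<le> dirichlet f" by (rule c(2)[OF fin])
  also have "\<dots> \<le> (\<Sum>\<^sub>\<infinity>g\<in>carrier \<G>. pmf \<mu> g * (min 1 (?l g / real N) * (2 * K * ?l g powr alpha0)))"
  proof (rule dirichlet_coset_kernel_le[OF \<mu>])
    show "f summable_on \<V>"
      by (rule finite_nonzero_values_imp_summable_on) (rule finite_subset[OF _ fin], auto)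
    have "(\<lambda>g. 2 * K * (?l g powr alpha0 * pmf \<mu> g) * min 1 (?l g / real N)) summable_on carrier \<G>"
      by (rule summable_on_mult_bounded[OF sm, where C = 1]) simp
    then show "(\<lambda>g. pmf \<mu> g * (min 1 (?l g / real N) * (2 * K * ?l g powr alpha0))) summable_on carrier \<G>"
      by (simp only: mult_ac)
    fix g Z assume g: "g \<in> carrier \<G>" and Z: "finite Z" "Z \<subseteq> \<V>"
    obtain w where w: "word_map w = g" "length w = word_length \<G> gr_gens g" by (rule geodesic_word[OF g])
    have "(\<Sum>T\<in>Z. (f T - f (T #>\<^bsub>\<G>\<^esub> g))\<^sup>2) = (\<Sum>T\<in>Z. (ramp N (coset_ray T) - ramp N (act w (coset_ray T)))\<^sup>2)"
    proof (rule sum.cong)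
      fix T assume "T \<in> Z"
      then have T: "T \<in> \<V>" using Z by blast
      have "coset_ray (T #>\<^bsub>\<G>\<^esub> g) = act w (coset_ray T)"
        using translate_coset(2)[OF T g] by (simp only: w(1)[symmetric] boundary_action_word_map)
      then show "(f T - f (T #>\<^bsub>\<G>\<^esub> g))\<^sup>2 = (ramp N (coset_ray T) - ramp N (act w (coset_ray T)))\<^sup>2"
        using T translate_coset(1)[OF T g] by (simp add: f_def)
    qed simp
    also have "\<dots> = (\<Sum>\<xi>\<in>coset_ray ` Z. (ramp N \<xi> - ramp N (act w \<xi>))\<^sup>2)"
      using inj_on_subset[OF inj_on_coset_ray Z(2)] by (simp add: sum.reindex)
    also have "\<dots> \<le> min 1 (length w / N) * (2 * K * real (length w) powr alpha0)"
      using Z K by (intro sum_ramp_diff_le) auto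
    finally show "(\<Sum>T\<in>Z. (f T - f (T #>\<^bsub>\<G>\<^esub> g))\<^sup>2) \<le> min 1 (?l g / real N) * (2 * K * ?l g powr alpha0)"
      by (simp only: w(2))
  qed
  also have "\<dots> < c" using N(2) by (simp only: mult_ac)
  finally show False by simp
qed

text \<open>Lengths are natural numbers, and a length 0 contributes 0 for every exponent; so the terms increase
with the exponent throughout.\<close>

lemma finite_moment_mono:
  assumes "finite_moment \<G> gr_gens \<beta> \<mu>" "\<gamma> \<le> \<beta>"
  shows "finite_moment \<G> gr_gens \<gamma> \<mu>"
  using assms(1) unfolding finite_moment_def
proof (rule summable_on_comparison_test)
  fix g
  let ?l = "word_length \<G> gr_gens g"
  have "real ?l powr \<gamma> \<le> real ?l powr \<beta>"
    using assms(2) by (cases "?l = 0") (auto intro: powr_mono)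
  then show "real ?l powr \<gamma> * pmf \<mu> g \<le> real ?l powr \<beta> * pmf \<mu> g"
    by (rule mult_right_mono) simp
qed simp

section \<open>The critical constant\<close>

theorem theorem5p7:
  shows "crit_const_rec grigorchuk_group gr_gens (ray_stabilizer grigorchuk_group (\<lambda>_. True))
           = ereal (ln 2 / ln lambda0)"
proof -
  let ?E = "{\<beta>. 0 \<le> \<beta> \<and> (\<exists>\<mu>. symmetric_prob \<G> \<mu> \<and> finite_moment \<G> gr_gens \<beta> \<mu> \<and>
      transient_chain \<V> (coset_kernel \<G> \<mu>))}"
  have upper: "\<beta> \<le> alpha0" if \<beta>: "\<beta> \<in> ?E" for \<beta>
  proof (rule ccontr)
    assume "\<not> \<beta> \<le> alpha0"
    then have "alpha0 \<le> \<beta>" by simp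
    then show False
      using \<beta> recurrent_if_alpha0_moment finite_moment_mono by blast
  qed
  have lower: "\<beta> \<in> ?E" if \<beta>: "0 \<le> \<beta>" "\<beta> < alpha0" for \<beta>
  proof -
    have "lambda0 powr \<beta> < lambda0 powr alpha0"
      using \<beta> lambda0_gt_2 by (intro powr_less_mono) auto
    then have "1 / 2 < 1 / lambda0 powr \<beta>"
      using lambda0_pos by (simp add: lambda0_powr_alpha0 field_simps)
    then obtain r where r: "1 / 2 < r" "r < 1 / lambda0 powr \<beta>" using dense by blast
    have "1 \<le> lambda0 powr \<beta>" using \<beta> lambda0_gt_2 by (intro ge_one_powr_ge_zero) auto
    then have "1 / lambda0 powr \<beta> \<le> 1 / 1" using lambda0_pos by (intro divide_left_mono) simp_all
    then have "r < 1" using r by simp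
    moreover have "r * lambda0 powr \<beta> < 1" using r lambda0_pos by (simp add: field_simps)
    ultimately have "finite_moment \<G> gr_gens \<beta> (flip_walk r)"
      "transient_chain \<V> (coset_kernel \<G> (flip_walk r))"
      using r \<beta> by (simp_all add: finite_moment_flip_walk transient_flip_walk)
    then show ?thesis using \<beta> symmetric_flip_walk by blast
  qed
  have "Sup (ereal ` ?E) = ereal alpha0"
  proof (rule antisym)
    show "Sup (ereal ` ?E) \<le> ereal alpha0"
      using upper by (intro SUP_least) simp
    show "ereal alpha0 \<le> Sup (ereal ` ?E)"
    proof (rule ccontr)
      assume "\<not> ereal alpha0 \<le> Sup (ereal ` ?E)"
      then have lt: "Sup (ereal ` ?E) < ereal alpha0" by simp
      have "ereal 0 \<le> Sup (ereal ` ?E)"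
        using lower[of 0] alpha0_pos by (intro SUP_upper) simp
      moreover obtain \<beta> where \<beta>: "Sup (ereal ` ?E) < ereal \<beta>" "ereal \<beta> < ereal alpha0"
        using ereal_dense2[OF lt] by blast
      ultimately have "ereal 0 \<le> ereal \<beta>" by (meson less_imp_le order_trans)
      then have "\<beta> \<in> ?E" using \<beta>(2) by (intro lower) simp_all
      then have "ereal \<beta> \<le> Sup (ereal ` ?E)" by (intro SUP_upper)
      then show False using \<beta>(1) by simp
    qed
  qed
  then show ?thesis by (simp add: crit_const_rec_def alpha0_def)
qed

end
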